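(* Let $X$ be a finite set of points in $\mathbb{R}^d$, and let $r\ge1$ and $m\ge0$ be integers. If $|X|\ge(d+1)(r-1)+m+1$, then $\mathbf{Tver}(X,r)$ is homologically $(m-1)$-connected, i.e. $\widetilde H_j(\mathbf{Tver}(X,r);\mathbb{Q})=0$ for all $-1\le j\le m-1$.
   Context: $\mathbf{Tver}(X,r)$ is the order complex of the poset of ordered tuples $(X_1,\ldots,X_r)$ of pairwise disjoint (possibly empty) subsets of $X$ with $\bigcap_{i=1}^r\mathrm{conv}(X_i)\neq\emptyset$, ordered by $(X_1,\ldots,X_r)\le(Y_1,\ldots,Y_r)$ iff $X_i\subseteq Y_i$ for all $i$; i.e. its vertices are these tuples and its simplices are the chains. $\widetilde H_{-1}=0$ means the complex has at least one vertex. *)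

theory Defs
  imports "HOL-Analysis.Analysis"
begin

text \<open>A finite strict partial order is given by a relation lt on a vertex set V.
  The simplices of its order complex are the chains; a chain with k elements
  (a (k-1)-simplex) is represented canonically as the strictly increasing list of
  its elements. The list of length 0 is the empty (-1)-simplex, used for
  reduced homology (augmentation).\<close>

definition simplices :: "('v \<Rightarrow> 'v \<Rightarrow> bool) \<Rightarrow> 'v set \<Rightarrow> nat \<Rightarrow> 'v list set" where
  "simplices lt V k = {s. length s = k \<and> set s \<subseteq> V \<and> sorted_wrt lt s}"

definition del_nth :: "nat \<Rightarrow> 'v list \<Rightarrow> 'v list" where
  "del_nth i s = take i s @ drop (Suc i) s"

definition bd :: "('v \<Rightarrow> 'v \<Rightarrow> bool) \<Rightarrow> 'v set \<Rightarrow> nat \<Rightarrow> ('v list \<Rightarrow> rat) \<Rightarrow> ('v list \<Rightarrow> rat)" where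
  "bd lt V k c = (\<lambda>t. \<Sum>s\<in>simplices lt V (Suc k). \<Sum>i<Suc k.
      if del_nth i s = t then (-1)^i * c s else 0)"

definition chain_on :: "('v \<Rightarrow> 'v \<Rightarrow> bool) \<Rightarrow> 'v set \<Rightarrow> nat \<Rightarrow> ('v list \<Rightarrow> rat) \<Rightarrow> bool" where
  "chain_on lt V k c \<longleftrightarrow> (\<forall>s. s \<notin> simplices lt V k \<longrightarrow> c s = 0)"

text \<open>\<open>\<widetilde>H_j(\<Delta>(V);\<rat>) = 0\<close> for j \<ge> -1: every reduced j-cycle is a boundary.
  j-chains live on simplices with k = j+1 vertices.\<close>

definition reduced_homology_vanishes ::
  "('v \<Rightarrow> 'v \<Rightarrow> bool) \<Rightarrow> 'v set \<Rightarrow> int \<Rightarrow> bool" where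
  "reduced_homology_vanishes lt V j \<longleftrightarrow>
     (let k = nat (j + 1) in
      \<forall>c. chain_on lt V k c \<and> (k = 0 \<or> (\<forall>t. bd lt V (k - 1) c t = 0)) \<longrightarrow>
          (\<exists>d. chain_on lt V (Suc k) d \<and> bd lt V k d = c))"

definition tver_vertices :: "'a::euclidean_space set \<Rightarrow> nat \<Rightarrow> 'a set list set" where
  "tver_vertices X r = {Xs. length Xs = r \<and> (\<forall>i<r. Xs ! i \<subseteq> X) \<and>
      (\<forall>i<r. \<forall>j<r. i \<noteq> j \<longrightarrow> Xs ! i \<inter> Xs ! j = {}) \<and>
      (\<Inter>i\<in>{..<r}. convex hull (Xs ! i)) \<noteq> {}}"

definition tver_lt :: "'a set list \<Rightarrow> 'a set list \<Rightarrow> bool" where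
  "tver_lt Xs Ys \<longleftrightarrow> list_all2 (\<subseteq>) Xs Ys \<and> Xs \<noteq> Ys"

end

theory Submission
  imports Defs
begin

text \<open>
  Write a tuple \<open>(X\<^sub>1, \<dots>, X\<^sub>r)\<close> as the partial function \<open>\<sigma>\<close> on \<open>X\<close> given by the pairs
  \<open>(x, i)\<close> with \<open>x \<in> X\<^sub>i\<close>. In the dual form of Sarkaria's transformation, the hulls intersect iff
  every \<open>(z\<^sub>1, \<dots>, z\<^sub>r)\<close> with \<open>z\<^sub>1 + \<dots> + z\<^sub>r = 0\<close> satisfies \<open>z\<^sub>i \<bullet> (x, 1) \<le> 0\<close> for some
  \<open>(x, i) \<in> \<sigma>\<close>. These \<open>z\<close> form a space of dimension \<open>(d + 1)(r - 1)\<close>. For any convex cone \<open>C\<close>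
  of such functions on the pairs, spanned by \<open>D\<close> of them, let \<open>U\<^sub>C\<close> be the poset of all \<open>\<sigma>\<close> on
  which every element of \<open>C\<close> is somewhere nonpositive; the claim is that the reduced homology of
  \<open>U\<^sub>C\<close> vanishes up to degree \<open>|X| - D - 2\<close>.

  Cut \<open>C\<close> by a hyperplane \<open>H = {y. y v = 0}\<close> for a pair \<open>v\<close> on which \<open>C\<close> takes both signs.
  The two halves satisfy \<open>U\<^bsub>C+\<^esub> \<inter> U\<^bsub>C-\<^esub> = U\<^bsub>C\<^esub>\<close> and, by convexity,
  \<open>U\<^bsub>C+\<^esub> \<union> U\<^bsub>C-\<^esub> = U\<^bsub>C \<inter> H\<^esub>\<close>; all are up-sets, so Mayer--Vietoris applies, and the drop of
  dimension in \<open>C \<inter> H\<close> pays for the shift of degree. When no cut is left, a single \<open>y \<in> C\<close> decides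
  membership in \<open>U\<^sub>C\<close>, which then retracts to the face poset of a join of \<open>|X|\<close> nonempty discrete
  sets.
\<close>

section \<open>Order complexes as complexes of finite chains\<close>

definition flags :: "'v::order set \<Rightarrow> nat \<Rightarrow> 'v set set" where
  "flags P k = {S. S \<subseteq> P \<and> finite S \<and> card S = k \<and> (\<forall>x\<in>S. \<forall>y\<in>S. x \<le> y \<or> y \<le> x)}"

definition supported :: "'v::order set \<Rightarrow> nat \<Rightarrow> ('v set \<Rightarrow> rat) \<Rightarrow> bool" where
  "supported P k c \<longleftrightarrow> (\<forall>S. S \<notin> flags P k \<longrightarrow> c S = 0)"

text \<open>For a chain \<open>insert u T\<close> with \<open>u\<close> outside \<open>T\<close>
  this is the position of \<open>u\<close>, hence the exponent in the sign of the face
  \<open>T\<close>.\<close>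

definition height :: "'v::order \<Rightarrow> 'v set \<Rightarrow> nat" where
  "height u T = card {t \<in> T. t < u}"

lemma height_insert:
  assumes "finite T" "u \<notin> T"
  shows "height v (insert u T) = height v T + (if u < v then 1 else 0)"
proof -
  have "{t \<in> insert u T. t < v} = (if u < v then insert u {t \<in> T. t < v} else {t \<in> T. t < v})"
    by auto
  then show ?thesis using assms by (simp add: height_def)
qed

lemma flags_Int: "flags A k \<inter> flags B k = flags (A \<inter> B) k"
  by (auto simp: flags_def)

lemma flags_mono: "A \<subseteq> B \<Longrightarrow> flags A k \<subseteq> flags B k"
  by (auto simp: flags_def)

lemma supported_mono: "supported A k c \<Longrightarrow> A \<subseteq> B \<Longrightarrow> supported B k c"
  using flags_mono [of A B k] unfolding supported_def by blast

lemma supported_Int: "supported A k c \<Longrightarrow> supported B k c \<Longrightarrow> supported (A \<inter> B) k c"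
  unfolding supported_def by (metis Int_iff flags_Int)

lemma supported_add: "supported A k c \<Longrightarrow> supported A k d \<Longrightarrow> supported A k (\<lambda>S. c S + d S)"
  by (simp add: supported_def)

lemma supported_diff: "supported A k c \<Longrightarrow> supported A k d \<Longrightarrow> supported A k (\<lambda>S. c S - d S)"
  by (simp add: supported_def)

lemma supported_split:
  assumes "flags (A \<union> B) k \<subseteq> flags A k \<union> flags B k" "supported (A \<union> B) k c"
  obtains a b where "supported A k a" "supported B k b" "\<And>S. c S = a S + b S"
proof
  show "supported A k (\<lambda>S. if S \<in> flags A k then c S else 0)"
    by (simp add: supported_def)
  show "supported B k (\<lambda>S. if S \<in> flags A k then 0 else c S)"
    using assms by (auto simp: supported_def)
qed auto

lemma flag_insertD:
  assumes "insert u T \<in> flags P (Suc k)" "u \<notin> T"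
  shows "T \<in> flags P k"
  using assms by (auto simp: flags_def)

lemma neg_one_power_cancel: "(-1) ^ n * ((-1) ^ n * x) = (x :: 'a::comm_ring_1)"
  by (simp flip: mult.assoc power_mult_distrib)

section \<open>The augmented chain complex of a finite poset\<close>

locale finite_ambient =
  fixes V :: "'v::order set"
  assumes finV: "finite V"
begin

text \<open>The sum runs over the elements to be inserted into the face \<open>T\<close>, not over
  the faces of a simplex. It refers to the ambient \<open>V\<close>, so that a single operator
  serves all subposets.\<close>

definition bdry :: "('v set \<Rightarrow> rat) \<Rightarrow> 'v set \<Rightarrow> rat" where
  "bdry c T = (\<Sum>u\<in>V - T. (-1) ^ height u T * c (insert u T))"

text \<open>Chains on \<open>k\<close> vertices are \<open>(k - 1)\<close>-chains, so this is the vanishing of the reduced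
  homology in degree \<open>k - 1\<close>. For \<open>k = 0\<close> the cycle condition is void.\<close>

definition exact_at :: "'v set \<Rightarrow> nat \<Rightarrow> bool" where
  "exact_at P k \<longleftrightarrow> (\<forall>c. supported P k c \<and> (\<forall>T. bdry c T = 0) \<longrightarrow>
     (\<exists>d. supported P (Suc k) d \<and> (\<forall>T. bdry d T = c T)))"

text \<open>Terms that insert an element outside \<open>W\<close> vanish on chains supported in
  \<open>P\<close>. This lets results proved in one ambient set be used in another.\<close>

lemma exact_at_subambient:
  assumes W: "P \<subseteq> W" "W \<subseteq> V"
  shows "finite_ambient.exact_at W P k \<longleftrightarrow> exact_at P k"
proof -
  interpret W: finite_ambient W
    using finV W(2) finite_subset by unfold_locales auto
  have "W.bdry c T = bdry c T" if "supported P j c" for j c T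
  proof -
    have "c (insert u T) = 0" if "u \<notin> W" for u
    proof -
      have "insert u T \<notin> flags P j" using that W(1) by (auto simp: flags_def)
      then show ?thesis using \<open>supported P j c\<close> by (simp add: supported_def)
    qed
    then show ?thesis
      unfolding W.bdry_def bdry_def using finV W(2) by (intro sum.mono_neutral_left) auto
  qed
  then show ?thesis unfolding W.exact_at_def exact_at_def by metis
qed

lemma bdry_add: "bdry (\<lambda>S. c S + d S) T = bdry c T + bdry d T"
  by (simp add: bdry_def distrib_left sum.distrib)

lemma bdry_diff: "bdry (\<lambda>S. c S - d S) T = bdry c T - bdry d T"
  by (simp add: bdry_def right_diff_distrib sum_subtractf)

lemma supported_bdry:
  assumes "supported P (Suc k) c"
  shows "supported P k (bdry c)"
  unfolding supported_def
proof (intro allI impI)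
  fix T assume "T \<notin> flags P k"
  then have "c (insert u T) = 0" if "u \<in> V - T" for u
    using that assms flag_insertD unfolding supported_def by blast
  then show "bdry c T = 0" by (simp add: bdry_def)
qed

text \<open>Two comparable elements can be inserted in two orders, and just one of the two heights
  changes by one, so the terms cancel in pairs.\<close>

lemma bdry_bdry:
  assumes c: "supported P k c"
  shows "bdry (bdry c) T = 0"
proof (cases "finite T")
  case False
  then have "c (insert v (insert u T)) = 0" for u v
    using c by (auto simp: supported_def flags_def)
  then show ?thesis by (simp add: bdry_def)
next
  case fT: True
  \<comment> \<open>The value 0 on the diagonal lets both sums range over \<open>V - T\<close>, so
    that swapping them yields antisymmetry.\<close>
  define F where "F u v = (if u = v then 0 else
      (-1) ^ height u T * ((-1) ^ height v (insert u T) * c (insert v (insert u T))))" for u v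
  have anti: "F u v = - F v u" if "u \<in> V - T" "v \<in> V - T" for u v
  proof (cases "u = v \<or> c (insert v (insert u T)) = 0")
    case True
    then show ?thesis by (auto simp: F_def insert_commute)
  next
    case False
    then have "insert v (insert u T) \<in> flags P k"
      using c by (auto simp: supported_def)
    then have "(u < v \<and> \<not> v < u) \<or> (v < u \<and> \<not> u < v)"
      using False by (auto simp: flags_def less_le)
    moreover have "u \<notin> T" "v \<notin> T" using that by auto
    ultimately show ?thesis using False
      by (auto simp: F_def height_insert fT insert_commute)
  qed
  have "bdry (bdry c) T = (\<Sum>u\<in>V-T. \<Sum>v\<in>V-T. F u v)"
    unfolding bdry_def
  proof (rule sum.cong [OF refl])
    fix u assume u: "u \<in> V - T"
    have "(\<Sum>v\<in>V-T. F u v) = (\<Sum>v\<in>V - insert u T. F u v)"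
      by (rule sum.mono_neutral_right) (use finV in \<open>auto simp: F_def\<close>)
    also have "\<dots> = (\<Sum>v\<in>V - insert u T. (-1) ^ height u T *
        ((-1) ^ height v (insert u T) * c (insert v (insert u T))))"
      by (rule sum.cong) (auto simp: F_def)
    finally show "(-1) ^ height u T *
        (\<Sum>v\<in>V - insert u T. (-1) ^ height v (insert u T) * c (insert v (insert u T)))
        = (\<Sum>v\<in>V-T. F u v)"
      by (simp add: sum_distrib_left)
  qed
  moreover have "(\<Sum>u\<in>V-T. \<Sum>v\<in>V-T. F u v) = (\<Sum>u\<in>V-T. \<Sum>v\<in>V-T. F v u)"
    by (rule sum.swap)
  moreover have "(\<Sum>u\<in>V-T. \<Sum>v\<in>V-T. F v u) = - (\<Sum>u\<in>V-T. \<Sum>v\<in>V-T. F u v)"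
    unfolding sum_negf [symmetric]
    using anti by (intro sum.cong [OF refl]) blast
  ultimately show ?thesis by linarith
qed

text \<open>Mayer--Vietoris. Split a cycle as \<open>a + b\<close>. Then
  \<open>bdry a = - bdry b\<close> is a cycle in \<open>A \<inter> B\<close>, bounded there by some
  \<open>e\<close>, and \<open>a - e\<close> and \<open>b + e\<close> are cycles in \<open>A\<close>
  and \<open>B\<close>, which bound separately.\<close>

lemma exact_at_Un:
  assumes spl: "\<And>k. flags (A \<union> B) k \<subseteq> flags A k \<union> flags B k"
    and A: "exact_at A k" and B: "exact_at B k" and AB: "k = 0 \<or> exact_at (A \<inter> B) (k - 1)"
  shows "exact_at (A \<union> B) k"
proof (cases k)
  case 0
  have "flags (A \<union> B) 0 = flags A 0" by (auto simp: flags_def)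
  then show ?thesis
    using A supported_mono [of A _ _ "A \<union> B"] 0 unfolding exact_at_def
    by (metis Un_upper1 supported_def)
next
  case (Suc n)
  show ?thesis unfolding exact_at_def
  proof (intro allI impI, elim conjE)
    fix c assume c: "supported (A \<union> B) k c" and cyc: "\<forall>T. bdry c T = 0"
    obtain a b where a: "supported A k a" and b: "supported B k b"
      and ab: "\<And>S. c S = a S + b S"
      using supported_split [OF spl c] by blast
    have ceq: "c = (\<lambda>S. a S + b S)" using ab by auto
    have opp: "bdry a T = - bdry b T" for T
      using cyc unfolding ceq bdry_add by (simp add: eq_neg_iff_add_eq_0)
    have "supported B n (bdry b)" using supported_bdry b Suc by blast
    then have "supported B n (bdry a)" by (simp add: supported_def opp)
    then have "supported (A \<inter> B) n (bdry a)"
      using supported_bdry a Suc supported_Int by blast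
    moreover have "\<forall>T. bdry (bdry a) T = 0" using bdry_bdry [OF a] by simp
    ultimately obtain e where e: "supported (A \<inter> B) k e" and be: "\<forall>T. bdry e T = bdry a T"
      using AB Suc unfolding exact_at_def by auto
    have eA: "supported A k e" and eB: "supported B k e"
      using e supported_mono by blast+
    have "\<forall>T. bdry (\<lambda>S. a S - e S) T = 0" by (simp add: bdry_diff be)
    then obtain p where p: "supported A (Suc k) p" "\<forall>T. bdry p T = a T - e T"
      using A supported_diff [OF a eA] unfolding exact_at_def by blast
    have "\<forall>T. bdry (\<lambda>S. b S + e S) T = 0" by (simp add: bdry_add be opp)
    then obtain q where q: "supported B (Suc k) q" "\<forall>T. bdry q T = b T + e T"
      using B supported_add [OF b eB] unfolding exact_at_def by blast
    have "supported (A \<union> B) (Suc k) (\<lambda>S. p S + q S)"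
      using p(1) q(1) supported_mono [of _ _ _ "A \<union> B"] by (intro supported_add) auto
    moreover have "\<forall>T. bdry (\<lambda>S. p S + q S) T = c T"
      by (simp add: bdry_add p q ab)
    ultimately show "\<exists>d. supported (A \<union> B) (Suc k) d \<and> (\<forall>T. bdry d T = c T)" by blast
  qed
qed

text \<open>The connecting map of Mayer--Vietoris. A cycle of the intersection bounds
  \<open>a\<close> in \<open>A\<close> and \<open>b\<close> in \<open>B\<close>. The cycle
  \<open>a - b\<close> of the union bounds some \<open>p + q\<close>, and
  \<open>a - bdry p = b + bdry q\<close> is then a filling that lies in both parts.\<close>

lemma exact_at_Int:
  assumes spl: "\<And>k. flags (A \<union> B) k \<subseteq> flags A k \<union> flags B k"
    and A: "exact_at A k" and B: "exact_at B k" and AB: "exact_at (A \<union> B) (Suc k)"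
  shows "exact_at (A \<inter> B) k"
  unfolding exact_at_def
proof (intro allI impI, elim conjE)
  fix c assume c: "supported (A \<inter> B) k c" and cyc: "\<forall>T. bdry c T = 0"
  have cA: "supported A k c" and cB: "supported B k c"
    using c supported_mono by blast+
  obtain a where a: "supported A (Suc k) a" "\<forall>T. bdry a T = c T"
    using A cA cyc unfolding exact_at_def by blast
  obtain b where b: "supported B (Suc k) b" "\<forall>T. bdry b T = c T"
    using B cB cyc unfolding exact_at_def by blast
  have "supported (A \<union> B) (Suc k) (\<lambda>S. a S - b S)"
    using a(1) b(1) supported_mono [of _ _ _ "A \<union> B"] by (intro supported_diff) auto
  moreover have "\<forall>T. bdry (\<lambda>S. a S - b S) T = 0" by (simp add: bdry_diff a b)
  ultimately obtain e where e: "supported (A \<union> B) (Suc (Suc k)) e" "\<forall>T. bdry e T = a T - b T"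
    using AB unfolding exact_at_def by blast
  obtain p q where p: "supported A (Suc (Suc k)) p" and q: "supported B (Suc (Suc k)) q"
    and pq: "\<And>S. e S = p S + q S"
    using supported_split [OF spl e(1)] by blast
  have eeq: "e = (\<lambda>S. p S + q S)" using pq by auto
  have eq: "a T - bdry p T = b T + bdry q T" for T
    using e(2) unfolding eeq bdry_add by (simp add: algebra_simps)
  have 1: "supported A (Suc k) (\<lambda>T. a T - bdry p T)"
    by (intro supported_diff a supported_bdry p)
  have "supported B (Suc k) (\<lambda>T. b T + bdry q T)"
    by (intro supported_add b supported_bdry q)
  with 1 have "supported (A \<inter> B) (Suc k) (\<lambda>T. a T - bdry p T)"
    unfolding eq [symmetric] by (rule supported_Int)
  moreover have "\<forall>T. bdry (\<lambda>T. a T - bdry p T) T = c T"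
    by (simp add: bdry_diff a bdry_bdry [OF p])
  ultimately show "\<exists>d. supported (A \<inter> B) (Suc k) d \<and> (\<forall>T. bdry d T = c T)" by blast
qed

lemma exact_at_cone:
  assumes PV: "P \<subseteq> V" and w: "w \<in> P" and comp: "\<And>u. u \<in> P \<Longrightarrow> u \<le> w \<or> w \<le> u"
  shows "exact_at P k"
  unfolding exact_at_def
proof (intro allI impI, elim conjE)
  fix c assume c: "supported P k c" and cyc: "\<forall>T. bdry c T = 0"
  \<comment> \<open>The cone over \<open>c\<close> with apex \<open>w\<close>; the sign gives the
    face opposite to \<open>w\<close> the coefficient 1.\<close>
  define h where "h S = (if w \<in> S then (-1) ^ height w S * c (S - {w}) else 0)" for S
  have hs: "supported P (Suc k) h"
    unfolding supported_def
  proof (intro allI impI)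
    fix S assume S: "S \<notin> flags P (Suc k)"
    have "S - {w} \<notin> flags P k" if "w \<in> S"
    proof
      assume f: "S - {w} \<in> flags P k"
      have fin: "finite S" and SP: "S \<subseteq> P" using f w by (auto simp: flags_def)
      have "card S = Suc k"
        using card_Suc_Diff1 [OF fin that] f unfolding flags_def by force
      moreover have "x \<le> y \<or> y \<le> x" if "x \<in> S" "y \<in> S" for x y
      proof (cases "x = w \<or> y = w")
        case True
        then show ?thesis using comp that SP by blast
      next
        case False
        then show ?thesis using f that by (simp add: flags_def)
      qed
      ultimately show False using S fin SP by (simp add: flags_def)
    qed
    then show "h S = 0" using c by (simp add: h_def supported_def)
  qed
  have "bdry h T = c T" for T
  proof (cases "finite T")
    case False
    then have "h (insert u T) = 0" for u using hs by (auto simp: supported_def flags_def)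
    moreover have "c T = 0" using c False by (auto simp: supported_def flags_def)
    ultimately show ?thesis by (simp add: bdry_def)
  next
    case fT: True
    show ?thesis
    proof (cases "w \<in> T")
      case False
      have "bdry h T = (\<Sum>u\<in>V-T. if u = w then c T else 0)"
        unfolding bdry_def
        by (rule sum.cong [OF refl])
          (use False fT in \<open>auto simp: h_def height_insert neg_one_power_cancel\<close>)
      also have "\<dots> = c T" using finV w PV False by (auto simp: sum.delta)
      finally show ?thesis .
    next
      case True
      define T' where "T' = T - {w}"
      have T: "T = insert w T'" "w \<notin> T'" and fT': "finite T'" using True fT by (auto simp: T'_def)
      have VT: "V - T' = insert w (V - T)" using T w PV by auto
      \<comment> \<open>For a face containing \<open>w\<close>, the cycle condition at
        \<open>T - {w}\<close> expresses \<open>c T\<close> through the other cofaces of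
        \<open>T - {w}\<close>.\<close>
      have "0 = (-1) ^ height w T * bdry c T'" using cyc by simp
      also have "\<dots> = (-1) ^ height w T * ((-1) ^ height w T' * c T
          + (\<Sum>u\<in>V-T. (-1) ^ height u T' * c (insert u T')))"
        unfolding bdry_def VT using finV True by (simp add: T)
      finally have "0 = (-1) ^ height w T * ((-1) ^ height w T' * c T
          + (\<Sum>u\<in>V-T. (-1) ^ height u T' * c (insert u T')))" .
      moreover have "(-1) ^ height w T * ((-1) ^ height w T' * c T) = c T"
        using fT' T(2) by (simp add: T(1) height_insert neg_one_power_cancel)
      ultimately have cT: "c T = - (\<Sum>u\<in>V-T. (-1) ^ height w T * ((-1) ^ height u T' * c (insert u T')))"
        by (simp add: distrib_left sum_distrib_left eq_neg_iff_add_eq_0)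
      show ?thesis unfolding cT bdry_def sum_negf [symmetric]
      proof (rule sum.cong [OF refl])
        fix u assume u: "u \<in> V - T"
        have ins: "insert u T - {w} = insert u T'" using u T True by auto
        show "(-1) ^ height u T * h (insert u T) = - ((-1) ^ height w T * ((-1) ^ height u T' * c (insert u T')))"
        proof (cases "u \<in> P")
          case True
          then have "(u < w \<and> \<not> w < u) \<or> (w < u \<and> \<not> u < w)"
            using comp [of u] u \<open>w \<in> T\<close> by (auto simp: less_le)
          moreover have "height u T = height u T' + (if w < u then 1 else 0)"
            using T fT' by (simp add: height_insert)
          moreover have "height w (insert u T) = height w T + (if u < w then 1 else 0)"
            using u fT by (simp add: height_insert)
          moreover have "h (insert u T) = (-1) ^ height w (insert u T) * c (insert u T')"
            using \<open>w \<in> T\<close> ins by (simp add: h_def)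
          ultimately show ?thesis by auto
        next
          case False
          then have "insert u T' \<notin> flags P k" by (auto simp: flags_def)
          then show ?thesis using c ins by (simp add: h_def supported_def)
        qed
      qed
    qed
  qed
  then show "\<exists>d. supported P (Suc k) d \<and> (\<forall>T. bdry d T = c T)" using hs by blast
qed

text \<open>The link of \<open>v\<close> is a cone with apex \<open>w\<close>.\<close>

lemma exact_at_insert_dominated:
  assumes PV: "P \<subseteq> V" and v: "v \<in> P" and w: "w \<in> P" "w \<noteq> v"
    and dom: "\<And>u. u \<in> P \<Longrightarrow> u \<le> v \<or> v \<le> u \<Longrightarrow> u \<le> w \<or> w \<le> u"
    and ac: "exact_at (P - {v}) k"
  shows "exact_at P k"
proof -
  \<comment> \<open>The star of \<open>v\<close>: chains through \<open>v\<close> lie in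
    \<open>B\<close>, all others in \<open>P - {v}\<close>, and the two parts meet in the
    link.\<close>
  define B where "B = {u \<in> P. u \<le> v \<or> v \<le> u}"
  have P: "P = (P - {v}) \<union> B" using v by (auto simp: B_def)
  have wB: "w \<in> B" using dom [of v] v w by (auto simp: B_def)
  have "flags ((P - {v}) \<union> B) k \<subseteq> flags (P - {v}) k \<union> flags B k" for k
    using P unfolding flags_def B_def by blast
  moreover have "exact_at B k"
    by (rule exact_at_cone [of _ v]) (use PV v in \<open>auto simp: B_def\<close>)
  moreover have "exact_at ((P - {v}) \<inter> B) k" for k
    by (rule exact_at_cone [of _ w]) (use PV w wB dom in \<open>auto simp: B_def\<close>)
  ultimately have "exact_at ((P - {v}) \<union> B) k" using ac by (intro exact_at_Un) auto
  then show ?thesis using P by simp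
qed

text \<open>Here \<open>f v\<close> is the greatest element of \<open>Q\<close> below
  \<open>v\<close>. If \<open>v\<close> is minimal in \<open>P - Q\<close>, everything strictly
  below it is in \<open>Q\<close> and hence below \<open>f v\<close>, so \<open>v\<close> is
  dominated by \<open>f v\<close> and can be deleted.\<close>

lemma exact_at_retract_below:
  assumes "P \<subseteq> V" "Q \<subseteq> P" "exact_at Q k"
    and "\<And>v. v \<in> P - Q \<Longrightarrow> f v \<in> Q \<and> f v < v \<and> (\<forall>u\<in>Q. u < v \<longrightarrow> u \<le> f v)"
  shows "exact_at P k"
  using assms(1,2,4)
proof (induction "card (P - Q)" arbitrary: P rule: less_induct)
  case less
  have fin: "finite (P - Q)" using less.prems(1) finV finite_subset by blast
  show ?case
  proof (cases "P - Q = {}")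
    case True
    then show ?thesis using less.prems(2) assms(3) by (simp add: subset_antisym)
  next
    case False
    then obtain v where v: "v \<in> P - Q" "\<And>u. u \<in> P - Q \<Longrightarrow> u \<le> v \<Longrightarrow> u = v"
      using finite_has_minimal [OF fin] by metis
    have fv: "f v \<in> Q" "f v < v" "\<And>u. u \<in> Q \<Longrightarrow> u < v \<Longrightarrow> u \<le> f v"
      using less.prems(3) [OF v(1)] by auto
    have "P - {v} - Q = P - Q - {v}" by auto
    then have "card (P - {v} - Q) < card (P - Q)"
      using card_Diff1_less [OF fin v(1)] by simp
    then have "exact_at (P - {v}) k"
      using less.prems v(1) by (intro less.hyps) auto
    moreover have "u \<le> f v \<or> f v \<le> u" if "u \<in> P" "u \<le> v \<or> v \<le> u" for u
      using that v fv by (metis DiffI order.strict_implies_order order.trans order_le_imp_less_or_eq)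
    ultimately show ?thesis
      using less.prems(1,2) v fv by (intro exact_at_insert_dominated [of P v "f v"]) auto
  qed
qed

text \<open>The order dual: a maximal element of \<open>P - Q\<close> is deleted first, because
  everything strictly above it is then in \<open>Q\<close> and above \<open>f v\<close>.\<close>

lemma exact_at_retract_above:
  assumes "P \<subseteq> V" "Q \<subseteq> P" "exact_at Q k"
    and "\<And>v. v \<in> P - Q \<Longrightarrow> f v \<in> Q \<and> v < f v \<and> (\<forall>u\<in>Q. v < u \<longrightarrow> f v \<le> u)"
  shows "exact_at P k"
  using assms(1,2,4)
proof (induction "card (P - Q)" arbitrary: P rule: less_induct)
  case less
  have fin: "finite (P - Q)" using less.prems(1) finV finite_subset by blast
  show ?case
  proof (cases "P - Q = {}")
    case True
    then show ?thesis using less.prems(2) assms(3) by (simp add: subset_antisym)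
  next
    case False
    then obtain v where v: "v \<in> P - Q" "\<And>u. u \<in> P - Q \<Longrightarrow> v \<le> u \<Longrightarrow> u = v"
      using finite_has_maximal [OF fin] by metis
    have fv: "f v \<in> Q" "v < f v" "\<And>u. u \<in> Q \<Longrightarrow> v < u \<Longrightarrow> f v \<le> u"
      using less.prems(3) [OF v(1)] by auto
    have "P - {v} - Q = P - Q - {v}" by auto
    then have "card (P - {v} - Q) < card (P - Q)"
      using card_Diff1_less [OF fin v(1)] by simp
    then have "exact_at (P - {v}) k"
      using less.prems v(1) by (intro less.hyps) auto
    moreover have "u \<le> f v \<or> f v \<le> u" if "u \<in> P" "u \<le> v \<or> v \<le> u" for u
      using that v fv by (metis DiffI order.strict_implies_order order.trans order_le_imp_less_or_eq)
    ultimately show ?thesis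
      using less.prems(1,2) v fv by (intro exact_at_insert_dominated [of P v "f v"]) auto
  qed
qed

end

section \<open>Transfer to chains represented by sorted lists\<close>

lemma sorted_wrt_less_unique:
  fixes xs ys :: "'v::order list"
  assumes "sorted_wrt (<) xs" "sorted_wrt (<) ys" "set xs = set ys"
  shows "xs = ys"
  using assms
proof (induction xs arbitrary: ys)
  case (Cons x xs)
  then obtain y zs where ys: "ys = y # zs" by (cases ys) auto
  have "x = y"
  proof (rule ccontr)
    assume "x \<noteq> y"
    then have "x < y" "y < x" using Cons.prems ys by auto
    then show False by simp
  qed
  moreover have "x \<notin> set xs" "y \<notin> set zs" using Cons.prems ys by auto
  ultimately have "set xs = set zs" using Cons.prems(3) ys by auto
  then show ?case using Cons ys \<open>x = y\<close> by simp
qed simp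

lemma chain_sorted_list:
  fixes S :: "'v::order set"
  assumes "finite S" "\<forall>x\<in>S. \<forall>y\<in>S. x \<le> y \<or> y \<le> x"
  shows "\<exists>xs. sorted_wrt (<) xs \<and> set xs = S"
  using assms
proof (induction "card S" arbitrary: S)
  case 0
  then show ?case by (metis card_0_eq empty_set sorted_wrt.simps(1))
next
  case (Suc n)
  then have "S \<noteq> {}" by auto
  then obtain m where m: "m \<in> S" "\<And>u. u \<in> S \<Longrightarrow> u \<le> m \<Longrightarrow> u = m"
    using finite_has_minimal [OF Suc.prems(1)] by metis
  have "n = card (S - {m})" using Suc.hyps(2) Suc.prems(1) m(1) by simp
  then obtain xs where xs: "sorted_wrt (<) xs" "set xs = S - {m}"
    using Suc.hyps(1) [of "S - {m}"] Suc.prems by blast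
  have "m < u" if "u \<in> S - {m}" for u
    using m that Suc.prems(2) by (metis DiffE insertI1 order_le_imp_less_or_eq)
  then have "sorted_wrt (<) (m # xs)" "set (m # xs) = S"
    using xs m(1) by auto
  then show ?case by blast
qed

text \<open>The goal speaks of a relation on a vertex set, the chain complex above of the order of a
  type; \<open>\<phi>\<close> links them. It will be \<open>tuple_graph\<close>, with inclusion as
  the order.\<close>

locale order_embedding =
  fixes lt :: "'v \<Rightarrow> 'v \<Rightarrow> bool" and V :: "'v set" and \<phi> :: "'v \<Rightarrow> 'w::order"
  assumes finite_dom: "finite V" and inj: "inj_on \<phi> V"
    and lt_iff: "\<And>a b. a \<in> V \<Longrightarrow> b \<in> V \<Longrightarrow> lt a b \<longleftrightarrow> \<phi> a < \<phi> b"

sublocale order_embedding \<subseteq> finite_ambient "\<phi> ` V"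
  using finite_dom by unfold_locales simp

context order_embedding
begin

lemma sorted_map: "set s \<subseteq> V \<Longrightarrow> sorted_wrt (<) (map \<phi> s) \<longleftrightarrow> sorted_wrt lt s"
  by (induction s) (auto simp: lt_iff subset_eq)

lemma distinct_simplex: "s \<in> simplices lt V k \<Longrightarrow> distinct s"
proof -
  assume "s \<in> simplices lt V k"
  then have "sorted_wrt (<) (map \<phi> s)" using sorted_map by (auto simp: simplices_def)
  then have "distinct (map \<phi> s)" by (induction s) auto
  then show "distinct s" by (simp add: distinct_map)
qed

lemma image_simplex:
  assumes "s \<in> simplices lt V k"
  shows "\<phi> ` set s \<in> flags (\<phi> ` V) k"
proof -
  have s: "set s \<subseteq> V" "sorted_wrt lt s" "length s = k"
    using assms by (auto simp: simplices_def)
  have "card (\<phi> ` set s) = k"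
    using s inj distinct_simplex [OF assms] by (metis card_image distinct_card inj_on_subset)
  moreover have "\<forall>a\<in>set s. \<forall>b\<in>set s. a = b \<or> lt a b \<or> lt b a"
    using s(2) by (induction s) auto
  then have "\<forall>a\<in>set s. \<forall>b\<in>set s. \<phi> a \<le> \<phi> b \<or> \<phi> b \<le> \<phi> a"
    using s(1) lt_iff by (metis less_le order_refl subset_iff)
  ultimately show ?thesis using s(1) by (auto simp: flags_def)
qed

lemma inj_simplex:
  assumes "s \<in> simplices lt V k" "t \<in> simplices lt V l" "\<phi> ` set s = \<phi> ` set t"
  shows "s = t"
proof -
  have "map \<phi> s = map \<phi> t"
    using assms sorted_map by (intro sorted_wrt_less_unique) (auto simp: simplices_def)
  moreover have "inj_on \<phi> (set s \<union> set t)"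
    using assms inj by (auto simp: simplices_def intro: inj_on_subset)
  ultimately show ?thesis by (rule map_inj_on)
qed

lemma flag_image_simplex:
  assumes "S \<in> flags (\<phi> ` V) k"
  obtains s where "s \<in> simplices lt V k" "\<phi> ` set s = S"
proof -
  obtain xs where xs: "sorted_wrt (<) xs" "set xs = S"
    using assms chain_sorted_list [of S] unfolding flags_def by blast
  define s where "s = map (inv_into V \<phi>) xs"
  have SV: "S \<subseteq> \<phi> ` V" using assms by (simp add: flags_def)
  have m: "map \<phi> s = xs"
    using xs SV unfolding s_def by (auto simp: map_idI f_inv_into_f subset_iff)
  have sV: "set s \<subseteq> V"
    using xs SV unfolding s_def by (auto intro: inv_into_into)
  have "distinct xs" using xs(1) by (induction xs) auto
  then have "length s = k" using assms xs by (auto simp: s_def flags_def distinct_card)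
  moreover have "sorted_wrt lt s" using sorted_map [OF sV] m xs by simp
  moreover have "\<phi> ` set s = S" using m xs(2) by (metis set_map)
  ultimately show ?thesis using that sV by (auto simp: simplices_def)
qed

text \<open>The last claim matches the signs of \<open>bd\<close> and \<open>bdry\<close>: in a
  sorted list the entries before position \<open>i\<close> are exactly those below
  \<open>s ! i\<close>.\<close>

lemma del_nth_simplex:
  assumes s: "s \<in> simplices lt V (Suc k)" and i: "i < Suc k"
  shows "del_nth i s \<in> simplices lt V k"
    and "set s = insert (s ! i) (set (del_nth i s))"
    and "s ! i \<notin> set (del_nth i s)"
    and "height (\<phi> (s ! i)) (\<phi> ` set (del_nth i s)) = i"
proof -
  have len: "i < length s" using s i by (simp add: simplices_def)
  have sp: "s = take i s @ s ! i # drop (Suc i) s" using len by (rule id_take_nth_drop)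
  have sV: "set s \<subseteq> V" using s by (simp add: simplices_def)
  show 1: "set s = insert (s ! i) (set (del_nth i s))"
    using arg_cong [OF sp, of set] by (auto simp: del_nth_def)
  have "distinct (take i s @ s ! i # drop (Suc i) s)"
    using distinct_simplex [OF s] sp by simp
  then show 2: "s ! i \<notin> set (del_nth i s)" by (simp add: del_nth_def)
  have srt: "sorted_wrt lt (take i s @ s ! i # drop (Suc i) s)"
    using s sp by (simp add: simplices_def)
  have "sorted_wrt lt (del_nth i s)"
    using srt unfolding del_nth_def sorted_wrt_append by simp
  moreover have "length (del_nth i s) = k"
    using s i by (simp add: simplices_def del_nth_def)
  ultimately show "del_nth i s \<in> simplices lt V k"
    using 1 sV by (auto simp: simplices_def)
  have lo: "\<phi> x < \<phi> (s ! i)" if "x \<in> set (take i s)" for x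
    using srt that sV 1 len set_take_subset [of i s] lt_iff [of x "s ! i"] nth_mem [OF len]
    by (auto simp: sorted_wrt_append)
  have hi: "\<phi> (s ! i) < \<phi> x" if "x \<in> set (drop (Suc i) s)" for x
    using srt that sV 1 len set_drop_subset [of "Suc i" s] lt_iff [of "s ! i" x] nth_mem [OF len]
    by (auto simp: sorted_wrt_append)
  have "{x \<in> \<phi> ` set (del_nth i s). x < \<phi> (s ! i)} = \<phi> ` set (take i s)"
    using lo hi by (auto simp: del_nth_def dest: order.asym)
  moreover have "card (\<phi> ` set (take i s)) = i"
  proof -
    have "inj_on \<phi> (set (take i s))"
      using inj sV set_take_subset by (metis inj_on_subset)
    then show ?thesis using distinct_simplex [OF s] len by (simp add: card_image distinct_card)
  qed
  ultimately show "height (\<phi> (s ! i)) (\<phi> ` set (del_nth i s)) = i"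
    by (simp add: height_def)
qed

lemma finite_simplices: "finite (simplices lt V k)"
proof (rule finite_subset)
  show "simplices lt V k \<subseteq> {s. set s \<subseteq> V \<and> length s = k}" by (auto simp: simplices_def)
  show "finite {s. set s \<subseteq> V \<and> length s = k}" using finite_dom by (rule finite_lists_length_eq)
qed

text \<open>\<open>bd\<close> sums over pairs of a simplex and a deleted position,
  \<open>bdry\<close> over inserted elements. Sending \<open>(s, i)\<close> to
  \<open>\<phi> (s ! i)\<close> is a bijection onto those insertions that give a chain;
  \<open>c'\<close> vanishes on the others.\<close>

lemma bd_eq_bdry:
  assumes t: "t \<in> simplices lt V k" and c': "supported (\<phi> ` V) (Suc k) c'"
    and cc: "\<And>s. s \<in> simplices lt V (Suc k) \<Longrightarrow> c' (\<phi> ` set s) = c s"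
  shows "bd lt V k c t = bdry c' (\<phi> ` set t)"
proof -
  define Z where "Z = {(s, i). s \<in> simplices lt V (Suc k) \<and> i < Suc k \<and> del_nth i s = t}"
  define U where "U = {u \<in> \<phi> ` V - \<phi> ` set t. insert u (\<phi> ` set t) \<in> flags (\<phi> ` V) (Suc k)}"
  let ?f = "\<lambda>(s, i). \<phi> (s ! i)"
  have "bd lt V k c t = (\<Sum>(s, i)\<in>simplices lt V (Suc k) \<times> {..<Suc k}.
      if del_nth i s = t then (-1)^i * c s else 0)"
    unfolding bd_def by (simp only: sum.cartesian_product)
  also have "\<dots> = (\<Sum>(s, i)\<in>Z. (-1)^i * c s)"
    unfolding Z_def
    by (rule sum.mono_neutral_cong_right) (auto simp: finite_simplices split: if_splits)
  also have "\<dots> = (\<Sum>u\<in>U. (-1) ^ height u (\<phi> ` set t) * c' (insert u (\<phi> ` set t)))"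
  proof -
    have ins: "insert (\<phi> (s ! i)) (\<phi> ` set t) = \<phi> ` set s" if "(s, i) \<in> Z" for s i
      using that del_nth_simplex(2) [of s k i] by (auto simp: Z_def)
    have "inj_on ?f Z"
    proof (rule inj_onI, clarify)
      fix s i s' i' assume a: "(s, i) \<in> Z" "(s', i') \<in> Z" "\<phi> (s ! i) = \<phi> (s' ! i')"
      then have "\<phi> ` set s = \<phi> ` set s'" using ins by metis
      then have "s = s'" using a inj_simplex by (auto simp: Z_def)
      moreover have "height (\<phi> (s ! i)) (\<phi> ` set t) = i"
        using a(1) del_nth_simplex(4) [of s k i] by (auto simp: Z_def)
      moreover have "height (\<phi> (s' ! i')) (\<phi> ` set t) = i'"
        using a(2) del_nth_simplex(4) [of s' k i'] by (auto simp: Z_def)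
      ultimately show "s = s' \<and> i = i'" using a(3) by metis
    qed
    moreover have "?f ` Z = U"
    proof (intro equalityI subsetI)
      fix u assume "u \<in> ?f ` Z"
      then obtain s i where si: "(s, i) \<in> Z" and u: "u = \<phi> (s ! i)" by auto
      have s: "s \<in> simplices lt V (Suc k)" "i < Suc k" "del_nth i s = t"
        using si by (auto simp: Z_def)
      have V: "set s \<subseteq> V" using s by (simp add: simplices_def)
      have "u \<notin> \<phi> ` set t"
        using del_nth_simplex(2,3) [OF s(1,2)] s(3) V inj u
        by (metis image_iff inj_on_image_mem_iff insert_subset)
      moreover have "u \<in> \<phi> ` V" using del_nth_simplex(2) [OF s(1,2)] V u by auto
      ultimately show "u \<in> U"
        using image_simplex [OF s(1)] ins [OF si] u by (auto simp: U_def)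
    next
      fix u assume u: "u \<in> U"
      then obtain s where s: "s \<in> simplices lt V (Suc k)" "\<phi> ` set s = insert u (\<phi> ` set t)"
        using flag_image_simplex unfolding U_def by blast
      have "u \<in> \<phi> ` set s" using s(2) by simp
      then obtain v where "v \<in> set s" "\<phi> v = u" by auto
      then obtain i where i: "i < length s" "\<phi> (s ! i) = u"
        by (metis in_set_conv_nth)
      then have ik: "i < Suc k" using s by (simp add: simplices_def)
      note d = del_nth_simplex [OF s(1) ik]
      have V: "set s \<subseteq> V" using s by (simp add: simplices_def)
      have "u \<notin> \<phi> ` set (del_nth i s)"
        using d(2,3) V inj i(2) by (metis image_iff inj_on_image_mem_iff insert_subset)
      moreover have "insert u (\<phi> ` set (del_nth i s)) = insert u (\<phi> ` set t)"
        using s(2) d(2) i(2) by (metis image_insert)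
      moreover have "u \<notin> \<phi> ` set t" using u by (simp add: U_def)
      ultimately have "\<phi> ` set (del_nth i s) = \<phi> ` set t" by (simp add: insert_ident)
      then have "del_nth i s = t" using inj_simplex d(1) t by blast
      then have "(s, i) \<in> Z" using s ik by (simp add: Z_def)
      then show "u \<in> ?f ` Z" using i(2) by force
    qed
    ultimately have bij: "bij_betw ?f Z U" by (simp add: bij_betw_def)
    have "(\<Sum>(s, i)\<in>Z. (-1)^i * c s) =
      (\<Sum>z\<in>Z. (-1) ^ height (?f z) (\<phi> ` set t) * c' (insert (?f z) (\<phi> ` set t)))"
    proof (rule sum.cong [OF refl], clarify)
      fix s i assume si: "(s, i) \<in> Z"
      then have "height (\<phi> (s ! i)) (\<phi> ` set t) = i" "c' (\<phi> ` set s) = c s"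
        using del_nth_simplex(4) [of s k i] cc [of s] by (auto simp: Z_def)
      then show "(-1)^i * c s = (-1) ^ height (\<phi> (s ! i)) (\<phi> ` set t) *
          c' (insert (\<phi> (s ! i)) (\<phi> ` set t))"
        by (simp add: ins [OF si])
    qed
    then show ?thesis
      using sum.reindex_bij_betw [OF bij, of "\<lambda>u. (-1) ^ height u (\<phi> ` set t) * c' (insert u (\<phi> ` set t))"]
      by simp
  qed
  also have "\<dots> = bdry c' (\<phi> ` set t)"
    unfolding bdry_def
    by (rule sum.mono_neutral_left) (use finite_dom c' in \<open>auto simp: U_def supported_def\<close>)
  finally show ?thesis .
qed

theorem reduced_homology_vanishes_if_exact_at:
  assumes ac: "exact_at (\<phi> ` V) k"
  shows "reduced_homology_vanishes lt V (int k - 1)"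
proof -
  have "\<exists>d. chain_on lt V (Suc k) d \<and> bd lt V k d = c"
    if c: "chain_on lt V k c" and cyc: "k = 0 \<or> (\<forall>t. bd lt V (k - 1) c t = 0)" for c
  proof -
    \<comment> \<open>By \<open>inj_simplex\<close> and \<open>flag_image_simplex\<close>, each flag
      is the image of exactly one simplex, so \<open>THE\<close> is meaningful.\<close>
    define c' where "c' T = (if T \<in> flags (\<phi> ` V) k
      then c (THE s. s \<in> simplices lt V k \<and> \<phi> ` set s = T) else 0)" for T
    have sup: "supported (\<phi> ` V) k c'" by (simp add: supported_def c'_def)
    have c'c: "c' (\<phi> ` set s) = c s" if "s \<in> simplices lt V k" for s
    proof -
      have "(THE s'. s' \<in> simplices lt V k \<and> \<phi> ` set s' = \<phi> ` set s) = s"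
        using that inj_simplex by (intro the_equality) auto
      then show ?thesis using image_simplex [OF that] by (simp add: c'_def)
    qed
    have "bdry c' T = 0" for T
    proof (cases k)
      case 0
      have "c' (insert u T) = 0" for u
        using sup unfolding supported_def flags_def 0 by (auto simp: card_eq_0_iff)
      then show ?thesis by (simp add: bdry_def)
    next
      case (Suc n)
      show ?thesis
      proof (cases "T \<in> flags (\<phi> ` V) n")
        case True
        then obtain t where "t \<in> simplices lt V n" "\<phi> ` set t = T"
          using flag_image_simplex by blast
        then show ?thesis using bd_eq_bdry [of t n c' c] sup c'c cyc Suc by auto
      next
        case False
        then show ?thesis using supported_bdry sup Suc unfolding supported_def by blast
      qed
    qed
    then obtain d' where d': "supported (\<phi> ` V) (Suc k) d'" "\<And>T. bdry d' T = c' T"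
      using ac sup unfolding exact_at_def by blast
    define d where "d s = (if s \<in> simplices lt V (Suc k) then d' (\<phi> ` set s) else 0)" for s
    have "bd lt V k d t = c t" for t
    proof (cases "t \<in> simplices lt V k")
      case True
      then show ?thesis using bd_eq_bdry [OF True d'(1), of d] d'(2) c'c by (simp add: d_def)
    next
      case False
      then have "del_nth i s \<noteq> t" if "s \<in> simplices lt V (Suc k)" "i < Suc k" for s i
        using del_nth_simplex(1) that by blast
      then have "bd lt V k d t = 0" unfolding bd_def by (intro sum.neutral) auto
      then show ?thesis using c False by (simp add: chain_on_def)
    qed
    moreover have "chain_on lt V (Suc k) d" by (simp add: chain_on_def d_def)
    ultimately show ?thesis by blast
  qed
  then show ?thesis by (simp add: reduced_homology_vanishes_def)
qed

end

section \<open>Cones of functions and partial sections\<close>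

text \<open>Partial sections of \<open>fst\<close> over \<open>B\<close>: the simplices, including
  the empty one, of the join of the fibres taken as discrete sets.\<close>

definition sections :: "('c \<times> 'l) set \<Rightarrow> ('c \<times> 'l) set set" where
  "sections B = {\<sigma>. \<sigma> \<subseteq> B \<and> single_valued \<sigma>}"

definition function_cone :: "('v \<Rightarrow> real) set \<Rightarrow> bool" where
  "function_cone C \<longleftrightarrow> (\<lambda>v. 0) \<in> C \<and>
     (\<forall>y\<in>C. \<forall>z\<in>C. \<forall>s\<ge>0. \<forall>t\<ge>0. (\<lambda>v. s * y v + t * z v) \<in> C)"

text \<open>A function in \<open>C\<close> that is positive on all of \<open>\<sigma>\<close> is a
  separation certificate; these are the sections without one. The empty section is excluded as soon
  as \<open>C\<close> is nonempty.\<close>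

definition blocked :: "('c \<times> 'l) set \<Rightarrow> ('c \<times> 'l \<Rightarrow> real) set \<Rightarrow> ('c \<times> 'l) set set" where
  "blocked E C = {\<sigma> \<in> sections E. \<forall>y\<in>C. \<exists>v\<in>\<sigma>. y v \<le> 0}"

text \<open>For finite \<open>I\<close> this bounds the dimension of the restriction of
  \<open>C\<close> to \<open>E\<close> by \<open>card I\<close>. The explicit index set makes it
  possible to delete one generator.\<close>

definition spanned_on :: "'v set \<Rightarrow> 'i set \<Rightarrow> ('v \<Rightarrow> real) set \<Rightarrow> bool" where
  "spanned_on E I C \<longleftrightarrow> (\<exists>g. \<forall>y\<in>C. \<exists>a. \<forall>v\<in>E. y v = (\<Sum>i\<in>I. a i * g i v))"

lemma function_coneD:
  assumes "function_cone C" "y \<in> C" "z \<in> C" "s \<ge> 0" "t \<ge> 0"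
  shows "(\<lambda>v. s * y v + t * z v) \<in> C"
  using assms by (simp add: function_cone_def)

text \<open>Add up the witnesses; nonnegativity on \<open>W\<close> prevents cancellation.\<close>

lemma function_cone_common_positive:
  assumes C: "function_cone C" and W: "finite W"
    and pos: "\<And>v. v \<in> W \<Longrightarrow> \<exists>y\<in>C. y v > 0"
    and nn: "\<And>v y. v \<in> W \<Longrightarrow> y \<in> C \<Longrightarrow> y v \<ge> 0"
  shows "\<exists>y\<in>C. \<forall>v\<in>W. y v > 0"
  using W pos nn
proof (induction W)
  case empty
  then show ?case using C by (auto simp: function_cone_def)
next
  case (insert w W)
  then obtain y where y: "y \<in> C" "\<forall>v\<in>W. y v > 0" by auto
  obtain z where z: "z \<in> C" "z w > 0" using insert.prems(1) by auto
  have "(\<lambda>v. 1 * y v + 1 * z v) \<in> C" using C y(1) z(1) by (intro function_coneD) auto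
  moreover have "1 * y v + 1 * z v > 0" if "v \<in> insert w W" for v
    using that y z insert.prems(2) [OF that y(1)] insert.prems(2) [OF that z(1)]
    by (auto intro: add_nonneg_pos add_pos_nonneg)
  ultimately show ?case by (intro bexI [of _ "\<lambda>v. 1 * y v + 1 * z v"]) auto
qed

lemma spanned_on_hyperplane:
  assumes I: "finite I" and span: "spanned_on E I C" and v0: "v0 \<in> E" and nz: "\<exists>y\<in>C. y v0 \<noteq> 0"
  obtains l where "l \<in> I" "spanned_on E (I - {l}) {y \<in> C. y v0 = 0}"
proof -
  obtain g where g: "\<And>y. y \<in> C \<Longrightarrow> \<exists>a. \<forall>v\<in>E. y v = (\<Sum>i\<in>I. a i * g i v)"
    using span by (auto simp: spanned_on_def)
  have "\<exists>l\<in>I. g l v0 \<noteq> 0"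
  proof (rule ccontr)
    assume "\<not> ?thesis"
    then show False using nz g v0 by fastforce
  qed
  then obtain l where l: "l \<in> I" "g l v0 \<noteq> 0" by blast
  \<comment> \<open>Gaussian elimination with pivot \<open>g l\<close>: every \<open>h i\<close>
    vanishes at \<open>v0\<close>, and \<open>h l\<close> vanishes identically.\<close>
  define h where "h i v = g i v - g i v0 / g l v0 * g l v" for i v
  have "\<exists>a. \<forall>v\<in>E. y v = (\<Sum>i\<in>I - {l}. a i * h i v)" if y: "y \<in> C" "y v0 = 0" for y
  proof -
    obtain a where a: "\<And>v. v \<in> E \<Longrightarrow> y v = (\<Sum>i\<in>I. a i * g i v)" using g y(1) by blast
    have "y v = (\<Sum>i\<in>I - {l}. a i * h i v)" if v: "v \<in> E" for v
    proof -
      have "(\<Sum>i\<in>I - {l}. a i * h i v) = (\<Sum>i\<in>I. a i * h i v)"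
        using I l by (intro sum.mono_neutral_left) (auto simp: h_def)
      also have "\<dots> = (\<Sum>i\<in>I. a i * g i v) - (\<Sum>i\<in>I. a i * g i v0) * (g l v / g l v0)"
        by (simp add: h_def right_diff_distrib sum_subtractf sum_distrib_left sum_distrib_right sum_divide_distrib mult_ac)
      also have "\<dots> = y v" using a [OF v] a [OF v0] y(2) by simp
      finally show ?thesis by simp
    qed
    then show ?thesis by blast
  qed
  then have "spanned_on E (I - {l}) {y \<in> C. y v0 = 0}" unfolding spanned_on_def by blast
  with l(1) show ?thesis using that by blast
qed

section \<open>Homology of posets of partial sections\<close>

context
  fixes E :: "('c \<times> 'l) set"
  assumes finE: "finite E"
begin

interpretation finite_ambient "Pow E"
  using finE by unfold_locales simp

text \<open>Induction on the number of fibres, and for a chosen fibre over \<open>x\<close> on its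
  labels. One label gives a contractible poset; each further label glues on another one along the
  join of the remaining fibres, where both the number of fibres and the degree are one less.\<close>

lemma exact_at_join:
  assumes "B \<subseteq> E" "k + 1 \<le> card (fst ` B)"
  shows "exact_at (sections B - {{}}) k"
  using assms
proof (induction "card (fst ` B)" arbitrary: B k)
  case 0
  then show ?case by simp
next
  case (Suc n)
  then obtain x where x: "x \<in> fst ` B" by (metis card.empty equals0I nat.distinct(1))
  define B' where "B' = {p \<in> B. fst p \<noteq> x}"
  define L where "L = {l. (x, l) \<in> B}"
  have finB: "finite B" using Suc.prems(1) finE finite_subset by blast
  have "fst ` B' = fst ` B - {x}" by (auto simp: B'_def)
  then have n: "n = card (fst ` B')" using Suc.hyps(2) x finB by simp
  have finL: "finite L"
    using finite_subset [of L "snd ` B"] finB by (force simp: L_def)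
  have neL: "L \<noteq> {}" using x by (auto simp: L_def)
  have B: "B = B' \<union> {x} \<times> L" by (auto simp: B'_def L_def)
  have xB': "(x, l) \<notin> B'" for l by (auto simp: B'_def)
  have BE: "B' \<subseteq> E" using Suc.prems(1) by (auto simp: B'_def)
  \<comment> \<open>Inserting \<open>(x, b)\<close> retracts onto the sections containing it, and
    these have the least element \<open>{(x, b)}\<close>.\<close>
  have point: "exact_at (sections (B' \<union> {x} \<times> {b}) - {{}}) k" if b: "b \<in> L" for b k
  proof -
    let ?P = "sections (B' \<union> {x} \<times> {b}) - {{}}"
    have "exact_at {\<sigma> \<in> ?P. (x, b) \<in> \<sigma>} k"
      by (rule exact_at_cone [of _ "{(x, b)}"])
        (use b Suc.prems(1) in \<open>auto simp: sections_def B single_valued_def\<close>)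
    moreover have "single_valued (insert (x, b) v)" if "v \<in> ?P" for v
    proof -
      have v: "v \<subseteq> insert (x, b) B'" "single_valued v" using that by (auto simp: sections_def)
      have "l = b" if "(x, l) \<in> v" for l using v(1) xB' that by blast
      then show ?thesis using v(2) unfolding single_valued_def by blast
    qed
    ultimately show ?thesis
      by (intro exact_at_retract_above [of ?P "{\<sigma> \<in> ?P. (x, b) \<in> \<sigma>}" _ "insert (x, b)"])
        (use b Suc.prems(1) in \<open>auto simp: sections_def B\<close>)
  qed
  have "exact_at (sections (B' \<union> {x} \<times> F) - {{}}) k" if "finite F" "F \<noteq> {}" "F \<subseteq> L" for F
    using that
  proof (induction F rule: finite_ne_induct)
    case (singleton b)
    then show ?case using point by simp
  next
    case (insert c F)
    let ?A = "sections (B' \<union> {x} \<times> F) - {{}}" and ?D = "sections (B' \<union> {x} \<times> {c}) - {{}}"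
    have eq: "?A \<union> ?D = sections (B' \<union> {x} \<times> insert c F) - {{}}"
    proof (intro equalityI subsetI)
      fix \<sigma> assume s: "\<sigma> \<in> sections (B' \<union> {x} \<times> insert c F) - {{}}"
      then have "single_valued \<sigma>" by (simp add: sections_def)
      show "\<sigma> \<in> ?A \<union> ?D"
      proof (cases "(x, c) \<in> \<sigma>")
        case True
        then have "(x, f) \<notin> \<sigma>" if "f \<in> F" for f
          using \<open>single_valued \<sigma>\<close> insert.hyps(3) that by (metis single_valuedD)
        then show ?thesis using s by (auto simp: sections_def)
      next
        case False
        then show ?thesis using s by (auto simp: sections_def)
      qed
    qed (auto simp: sections_def)
    have int: "?A \<inter> ?D = sections B' - {{}}"
      using xB' insert.hyps(3) by (auto simp: sections_def)
    have "flags (?A \<union> ?D) j \<subseteq> flags ?A j \<union> flags ?D j" for j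
    proof
      fix S assume S: "S \<in> flags (?A \<union> ?D) j"
      \<comment> \<open>Otherwise the larger of two comparable sections would give \<open>x\<close>
        both the label \<open>c\<close> and a label in \<open>F\<close>.\<close>
      have "S \<subseteq> ?A \<or> S \<subseteq> ?D"
      proof (rule ccontr)
        assume "\<not> ?thesis"
        then obtain \<sigma> \<tau> where st: "\<sigma> \<in> S" "\<tau> \<in> S" "\<sigma> \<notin> ?A" "\<tau> \<notin> ?D" by blast
        have "\<sigma> \<in> ?A \<union> ?D" "\<tau> \<in> ?A \<union> ?D" "\<sigma> \<subseteq> \<tau> \<or> \<tau> \<subseteq> \<sigma>"
          using S st by (auto simp: flags_def)
        moreover from this obtain f where "(x, c) \<in> \<sigma>" "f \<in> F" "(x, f) \<in> \<tau>"
          using st(3,4) by (auto simp: sections_def)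
        ultimately show False
          using insert.hyps(3) by (auto simp: sections_def dest: single_valuedD)
      qed
      then show "S \<in> flags ?A j \<union> flags ?D j" using S by (auto simp: flags_def)
    qed
    moreover have "exact_at ?A k" using insert by blast
    moreover have "exact_at ?D k" using insert.prems point by auto
    moreover have "k = 0 \<or> exact_at (?A \<inter> ?D) (k - 1)"
      unfolding int using Suc.hyps(1) [OF n BE, of "k - 1"] Suc.prems(2) Suc.hyps(2) n by (cases k) auto
    ultimately show ?case using exact_at_Un eq by metis
  qed
  then show ?case using finL neL B by auto
qed

text \<open>\<open>\<sigma> \<inter> B\<close> is the largest section of \<open>B\<close> inside
  \<open>\<sigma>\<close>, so the poset retracts to the join over \<open>B\<close>.\<close>

lemma exact_at_meets:
  assumes B: "B \<subseteq> E" "k + 1 \<le> card (fst ` B)"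
  shows "exact_at {\<sigma> \<in> sections E. \<sigma> \<inter> B \<noteq> {}} k"
proof (rule exact_at_retract_below [where f = "\<lambda>\<sigma>. \<sigma> \<inter> B"])
  show "exact_at (sections B - {{}}) k" by (rule exact_at_join [OF B])
  show "{\<sigma> \<in> sections E. \<sigma> \<inter> B \<noteq> {}} \<subseteq> Pow E" by (auto simp: sections_def)
  show "sections B - {{}} \<subseteq> {\<sigma> \<in> sections E. \<sigma> \<inter> B \<noteq> {}}"
    using B(1) by (auto simp: sections_def)
  show "v \<inter> B \<in> sections B - {{}} \<and> v \<inter> B < v \<and> (\<forall>u\<in>sections B - {{}}. u < v \<longrightarrow> u \<le> v \<inter> B)"
    if "v \<in> {\<sigma> \<in> sections E. \<sigma> \<inter> B \<noteq> {}} - (sections B - {{}})" for v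
    using that by (auto simp: sections_def intro: single_valued_subset)
qed

text \<open>Induction on the number of pairs where \<open>C\<close> takes both signs. Cutting at
  such a pair \<open>v0\<close> removes it from this count for both halves and for the hyperplane
  part. For the latter the degree rises by one while a generator is lost, so
  \<open>k + card I\<close> is unchanged.\<close>

theorem exact_at_blocked:
  assumes X: "fst ` E = X"
    and "function_cone C" "\<And>y x. y \<in> C \<Longrightarrow> x \<in> X \<Longrightarrow> \<exists>l. (x, l) \<in> E \<and> y (x, l) \<le> 0"
    and "finite (I :: 'i set)" "spanned_on E I C" "k + card I + 1 \<le> card X"
  shows "exact_at (blocked E C) k"
  using assms(2-)
proof (induction "card {v \<in> E. (\<exists>y\<in>C. y v > 0) \<and> (\<exists>y\<in>C. y v < 0)}" arbitrary: C I k rule: less_induct)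
  case less
  note cone = less.prems(1)
  let ?mix = "\<lambda>C. {v \<in> E. (\<exists>y\<in>C. y v > 0) \<and> (\<exists>y\<in>C. y v < 0)}"
  have fmix: "finite (?mix C)" for C using finE by simp
  show ?case
  proof (cases "?mix C = {}")
    case True
    \<comment> \<open>Without mixed signs, functions in \<open>C\<close> are nonnegative on
      \<open>W\<close> and nonpositive on the rest of \<open>E\<close>. Hence one \<open>y0\<close>
      positive on all of \<open>W\<close> decides membership: \<open>\<sigma>\<close> is blocked iff
      it leaves \<open>W\<close>.\<close>
    define W where "W = {v \<in> E. \<exists>y\<in>C. y v > 0}"
    have nn: "y v \<ge> 0" if "v \<in> W" "y \<in> C" for v y
      using True that unfolding W_def by (smt (verit) empty_iff mem_Collect_eq)
    have "\<exists>y\<in>C. \<forall>v\<in>W. y v > 0"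
    proof (rule function_cone_common_positive [OF cone])
      show "finite W" using finE by (simp add: W_def)
      show "\<exists>y\<in>C. y v > 0" if "v \<in> W" for v using that by (simp add: W_def)
      show "y v \<ge> 0" if "v \<in> W" "y \<in> C" for v y using nn that .
    qed
    then obtain y0 where y0: "y0 \<in> C" "\<forall>v\<in>W. y0 v > 0" by blast
    have neg: "y0 v \<le> 0 \<longleftrightarrow> v \<notin> W" if "v \<in> E" for v
    proof -
      have "v \<in> W \<Longrightarrow> y0 v > 0" using y0(2) by blast
      moreover have "v \<notin> W \<Longrightarrow> y0 v \<le> 0" using that y0(1) by (force simp: W_def)
      ultimately show ?thesis by force
    qed
    have "blocked E C = {\<sigma> \<in> sections E. \<sigma> \<inter> (E - W) \<noteq> {}}"
    proof (intro equalityI subsetI)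
      fix \<sigma> assume "\<sigma> \<in> blocked E C"
      then show "\<sigma> \<in> {\<sigma> \<in> sections E. \<sigma> \<inter> (E - W) \<noteq> {}}"
        using y0(1) neg by (fastforce simp: blocked_def sections_def)
    next
      fix \<sigma> assume s: "\<sigma> \<in> {\<sigma> \<in> sections E. \<sigma> \<inter> (E - W) \<noteq> {}}"
      then obtain v where "v \<in> \<sigma>" "v \<in> E" "v \<notin> W" by auto
      then have "\<forall>y\<in>C. y v \<le> 0" by (auto simp: W_def not_less)
      then show "\<sigma> \<in> blocked E C" using s \<open>v \<in> \<sigma>\<close> by (auto simp: blocked_def)
    qed
    moreover have "fst ` (E - W) = X"
    proof
      show "X \<subseteq> fst ` (E - W)"
      proof
        fix x assume "x \<in> X"
        then obtain l where "(x, l) \<in> E" "y0 (x, l) \<le> 0" using less.prems(2) [OF y0(1)] by blast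
        then have "(x, l) \<in> E - W" using neg by blast
        then show "x \<in> fst ` (E - W)" by force
      qed
    qed (use X in auto)
    ultimately show ?thesis using exact_at_meets [of "E - W" k] less.prems(5) by simp
  next
    case False
    then obtain v0 where v0: "v0 \<in> E" "\<exists>y\<in>C. y v0 > 0" "\<exists>y\<in>C. y v0 < 0" by blast
    define Cp where "Cp = {y \<in> C. y v0 \<ge> 0}"
    define Cn where "Cn = {y \<in> C. y v0 \<le> 0}"
    define H where "H = {y \<in> C. y v0 = 0}"
    have coneP: "function_cone Cp" and coneN: "function_cone Cn" and coneH: "function_cone H"
      using cone by (auto simp: function_cone_def Cp_def Cn_def H_def
          intro: add_nonneg_nonneg add_nonpos_nonpos mult_nonneg_nonpos)
    have drop: "card (?mix D) < card (?mix C)"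
      if "D \<subseteq> C" "(\<forall>y\<in>D. y v0 \<ge> 0) \<or> (\<forall>y\<in>D. y v0 \<le> 0)" for D
    proof (rule psubset_card_mono [OF fmix])
      have "v0 \<in> ?mix C" "v0 \<notin> ?mix D" using v0 that by (auto simp: not_less)
      moreover have "?mix D \<subseteq> ?mix C" using that(1) by blast
      ultimately show "?mix D \<subset> ?mix C" by blast
    qed
    have spanD: "spanned_on E I D" if "D \<subseteq> C" for D
      using less.prems(4) that unfolding spanned_on_def by blast
    have p: "exact_at (blocked E Cp) k"
      by (rule less.hyps [OF drop coneP _ less.prems(3) spanD less.prems(5)])
        (use less.prems(2) in \<open>auto simp: Cp_def\<close>)
    have n: "exact_at (blocked E Cn) k"
      by (rule less.hyps [OF drop coneN _ less.prems(3) spanD less.prems(5)])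
        (use less.prems(2) in \<open>auto simp: Cn_def\<close>)
    have "\<exists>y\<in>C. y v0 \<noteq> 0" using v0(2) by (metis less_irrefl)
    then obtain l where l: "l \<in> I" "spanned_on E (I - {l}) H"
      using spanned_on_hyperplane [OF less.prems(3,4) v0(1)] unfolding H_def by blast
    have "card I = Suc (card (I - {l}))" using l(1) less.prems(3) by (metis card_Suc_Diff1)
    then have h: "exact_at (blocked E H) (Suc k)"
      using less.prems(2,3,5) l
      by (intro less.hyps [OF drop coneH, of "I - {l}"]) (auto simp: H_def)
    have Int: "blocked E Cp \<inter> blocked E Cn = blocked E C"
      unfolding blocked_def Cp_def Cn_def by (auto simp: Ball_def) (meson linear)
    have Un: "blocked E Cp \<union> blocked E Cn = blocked E H"
    proof (intro equalityI subsetI)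
      fix \<sigma> assume s: "\<sigma> \<in> blocked E H"
      show "\<sigma> \<in> blocked E Cp \<union> blocked E Cn"
      proof (rule ccontr)
        assume "\<not> ?thesis"
        then obtain y z where y: "y \<in> C" "y v0 \<ge> 0" "\<forall>v\<in>\<sigma>. y v > 0"
          and z: "z \<in> C" "z v0 \<le> 0" "\<forall>v\<in>\<sigma>. z v > 0"
          using s by (auto simp: blocked_def Cp_def Cn_def not_le)
        have "\<exists>u\<in>H. \<forall>v\<in>\<sigma>. u v > 0"
        proof (cases "y v0 = 0 \<or> z v0 = 0")
          case True
          then show ?thesis using y z by (auto simp: H_def)
        next
          case False
          \<comment> \<open>Both coefficients are positive here, and they are chosen so that
            \<open>u\<close> vanishes at \<open>v0\<close>.\<close>
          define u where "u v = (- z v0) * y v + y v0 * z v" for v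
          have "u \<in> C" unfolding u_def [abs_def] using y z by (intro function_coneD [OF cone]) auto
          moreover have "u v0 = 0" by (simp add: u_def)
          moreover have "u v > 0" if "v \<in> \<sigma>" for v
            unfolding u_def using y z False that by (intro add_pos_pos mult_pos_pos) auto
          ultimately show ?thesis by (auto simp: H_def)
        qed
        then show False using s by (force simp: blocked_def)
      qed
    qed (auto simp: blocked_def Cp_def Cn_def H_def)
    have "flags (blocked E Cp \<union> blocked E Cn) j \<subseteq> flags (blocked E Cp) j \<union> flags (blocked E Cn) j" for j
    proof
      fix S assume S: "S \<in> flags (blocked E Cp \<union> blocked E Cn) j"
      have up: "\<tau> \<in> blocked E D" if "\<sigma> \<in> blocked E D" "\<sigma> \<subseteq> \<tau>" "\<tau> \<in> sections E" for \<sigma> \<tau> D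
        using that by (fastforce simp: blocked_def)
      have sec: "\<sigma> \<in> sections E" if "\<sigma> \<in> S" for \<sigma>
        using S that by (auto simp: flags_def blocked_def)
      \<comment> \<open>Both parts are up-sets, so the larger of two comparable sections would lie
        in the part that it misses.\<close>
      have "S \<subseteq> blocked E Cp \<or> S \<subseteq> blocked E Cn"
      proof (rule ccontr)
        assume "\<not> ?thesis"
        then obtain \<sigma> \<tau> where st: "\<sigma> \<in> S" "\<tau> \<in> S" "\<sigma> \<notin> blocked E Cp" "\<tau> \<notin> blocked E Cn" by blast
        then have "\<sigma> \<in> blocked E Cn" "\<tau> \<in> blocked E Cp" "\<sigma> \<subseteq> \<tau> \<or> \<tau> \<subseteq> \<sigma>"
          using S by (auto simp: flags_def)
        then show False using st up sec by blast
      qed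
      then show "S \<in> flags (blocked E Cp) j \<union> flags (blocked E Cn) j" using S by (auto simp: flags_def)
    qed
    then have "exact_at (blocked E Cp \<inter> blocked E Cn) k"
      using p n h Un by (intro exact_at_Int) auto
    then show ?thesis using Int by simp
  qed
qed

end

section \<open>Separation of convex hulls\<close>

text \<open>A vector paired with \<open>(x, 1)\<close> is an affine function of \<open>x\<close>.
  The set \<open>A\<close> at height 0 is disjoint from the epigraph of \<open>w\<close> over
  \<open>B\<close>; a separating hyperplane that is a graph gives \<open>u\<close> with
  \<open>0 < u\<close> on \<open>A\<close> and \<open>u < w\<close> on \<open>B\<close>.\<close>

lemma split_positive_affine:
  fixes A B :: "'a::euclidean_space set" and w :: "'a \<times> real"
  assumes A: "compact A" "convex A" and B: "compact B" "convex B"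
    and pos: "\<And>x. x \<in> A \<inter> B \<Longrightarrow> w \<bullet> (x, 1) > 0"
  obtains u where "\<And>x. x \<in> A \<Longrightarrow> u \<bullet> (x, 1) > 0" "\<And>x. x \<in> B \<Longrightarrow> (w - u) \<bullet> (x, 1) > 0"
proof (cases "A = {} \<or> B = {}")
  case True
  then consider "A = {}" | "B = {}" by blast
  then show ?thesis
  proof cases
    case 1
    \<comment> \<open>The vector \<open>(0, 1)\<close> is the constant function 1.\<close>
    then show ?thesis by (intro that [of "w - (0, 1)"]) (simp_all add: inner_prod_def)
  next
    case 2
    then show ?thesis by (intro that [of "(0, 1)"]) (simp_all add: inner_prod_def)
  qed
next
  case False
  define N where "N = {p. fst p \<in> B \<and> w \<bullet> (fst p, 1) \<le> snd p}"
  have "closed N"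
  proof -
    have "closed (B \<times> (UNIV :: real set))" using B(1) by (simp add: closed_Times compact_imp_closed)
    moreover have "closed {p :: 'a \<times> real. w \<bullet> (fst p, 1) \<le> snd p}"
      by (intro closed_Collect_le continuous_intros)
    ultimately have "closed ((B \<times> UNIV) \<inter> {p. w \<bullet> (fst p, 1) \<le> snd p})" by (rule closed_Int)
    moreover have "N = (B \<times> UNIV) \<inter> {p. w \<bullet> (fst p, 1) \<le> snd p}" by (auto simp: N_def)
    ultimately show ?thesis by simp
  qed
  moreover have "convex N"
  proof (rule convexI)
    fix p q :: "'a \<times> real" and s t :: real
    assume a: "p \<in> N" "q \<in> N" "0 \<le> s" "0 \<le> t" "s + t = 1"
    have "w \<bullet> (fst (s *\<^sub>R p + t *\<^sub>R q), 1) = s * (w \<bullet> (fst p, 1)) + t * (w \<bullet> (fst q, 1))"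
    proof -
      have "snd w = s * snd w + t * snd w" using a(5) by (metis distrib_right mult_1)
      then show ?thesis by (simp add: inner_prod_def inner_add_right distrib_left)
    qed
    also have "\<dots> \<le> s * snd p + t * snd q"
      using a by (intro add_mono mult_left_mono) (auto simp: N_def)
    finally show "s *\<^sub>R p + t *\<^sub>R q \<in> N"
      using a convexD [OF B(2)] by (simp add: N_def)
  qed
  moreover have "(A \<times> {0}) \<inter> N = {}" using pos by (force simp: N_def)
  moreover have "convex (A \<times> {0 :: real})" "compact (A \<times> {0 :: real})" "A \<times> {0 :: real} \<noteq> {}"
    using A False by (auto intro: convex_Times compact_Times)
  ultimately obtain ab \<gamma> where sep: "\<forall>p\<in>A \<times> {0}. ab \<bullet> p < \<gamma>" "\<forall>p\<in>N. ab \<bullet> p > \<gamma>"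
    using separating_hyperplane_compact_closed [of "A \<times> {0}" N] by blast
  obtain \<alpha> \<beta> where ab: "ab = (\<alpha>, \<beta>)" by (cases ab)
  have sepA: "\<alpha> \<bullet> a < \<gamma>" if "a \<in> A" for a
    using sep(1) that by (auto simp: ab inner_prod_def)
  have sepB: "\<gamma> < \<alpha> \<bullet> b + \<beta> * t" if "b \<in> B" "w \<bullet> (b, 1) \<le> t" for b t
    using sep(2) that by (auto simp: ab inner_prod_def N_def)
  \<comment> \<open>\<open>N\<close> is unbounded upwards, so a negative \<open>\<beta>\<close>
    would violate \<open>sepB\<close> for large \<open>t\<close>.\<close>
  have "\<beta> \<ge> 0"
  proof (rule ccontr)
    assume neg: "\<not> ?thesis"
    obtain b where b: "b \<in> B" using False by blast
    define t where "t = max (w \<bullet> (b, 1)) ((\<gamma> - \<alpha> \<bullet> b) / \<beta>)"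
    have "\<beta> * t \<le> \<beta> * ((\<gamma> - \<alpha> \<bullet> b) / \<beta>)"
      using neg by (intro mult_left_mono_neg) (auto simp: t_def)
    then have "\<beta> * t \<le> \<gamma> - \<alpha> \<bullet> b" using neg by simp
    then show False using sepB [OF b, of t] by (simp add: t_def)
  qed
  \<comment> \<open>The separating hyperplane may be vertical; tilting it slightly makes it a graph.\<close>
  define h where "h b = \<alpha> \<bullet> b + \<beta> * (w \<bullet> (b, 1)) - \<gamma>" for b
  have "continuous_on B h" unfolding h_def [abs_def] by (intro continuous_intros)
  then obtain b0 where b0: "b0 \<in> B" "\<And>b. b \<in> B \<Longrightarrow> h b0 \<le> h b"
    using continuous_attains_inf [OF B(1)] False by metis
  have hpos: "h b0 > 0" using sepB [OF b0(1) order_refl] by (simp add: h_def)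
  have "continuous_on B (\<lambda>b. \<bar>w \<bullet> (b, 1)\<bar>)" by (intro continuous_intros)
  then obtain b1 where b1: "b1 \<in> B" "\<And>b. b \<in> B \<Longrightarrow> \<bar>w \<bullet> (b, 1)\<bar> \<le> \<bar>w \<bullet> (b1, 1)\<bar>"
    using continuous_attains_sup [OF B(1)] False by metis
  define M where "M = \<bar>w \<bullet> (b1, 1)\<bar>"
  \<comment> \<open>\<open>h b0\<close> is the least slack over \<open>B\<close> and
    \<open>M\<close> bounds the absolute value of \<open>w\<close> there. Dividing by
    \<open>M + 1\<close> avoids a zero denominator and makes \<open>\<epsilon> * M\<close> strictly
    smaller than the slack.\<close>
  define \<epsilon> where "\<epsilon> = h b0 / (M + 1)"
  have M: "M \<ge> 0" by (simp add: M_def)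
  have eps: "\<epsilon> > 0" using hpos M by (simp add: \<epsilon>_def)
  have "\<epsilon> * M < h b0"
    using hpos M by (simp add: \<epsilon>_def field_simps)
  then have tilt: "\<gamma> < \<alpha> \<bullet> b + (\<beta> + \<epsilon>) * (w \<bullet> (b, 1))" if "b \<in> B" for b
  proof -
    have "\<epsilon> * - (w \<bullet> (b, 1)) \<le> \<epsilon> * M"
      using b1(2) [OF that] eps by (intro mult_left_mono) (auto simp: M_def)
    then show ?thesis
      using b0(2) [OF that] \<open>\<epsilon> * M < h b0\<close> by (simp add: h_def algebra_simps)
  qed
  define u where "u = (1 / (\<beta> + \<epsilon>)) *\<^sub>R (- \<alpha>, \<gamma>)"
  have u: "u \<bullet> (x, 1) = (\<gamma> - \<alpha> \<bullet> x) / (\<beta> + \<epsilon>)" for x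
    by (simp add: u_def inner_prod_def diff_divide_distrib)
  have be: "\<beta> + \<epsilon> > 0" using eps \<open>\<beta> \<ge> 0\<close> by simp
  show ?thesis
  proof (rule that)
    show "u \<bullet> (x, 1) > 0" if "x \<in> A" for x
      using sepA [OF that] be by (simp add: u)
    show "(w - u) \<bullet> (x, 1) > 0" if "x \<in> B" for x
      using tilt [OF that] be by (simp add: u inner_diff_left pos_divide_less_eq algebra_simps)
  qed
qed

text \<open>Split off the last set against the intersection of the earlier ones, then recurse on
  that intersection.\<close>

lemma decompose_positive_affine:
  fixes S :: "nat \<Rightarrow> 'a::euclidean_space set" and w :: "'a \<times> real"
  assumes "\<And>i. i \<le> n \<Longrightarrow> compact (S i) \<and> convex (S i)"
    and "\<And>x. x \<in> (\<Inter>i\<le>n. S i) \<Longrightarrow> w \<bullet> (x, 1) > 0"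
  shows "\<exists>z. (\<Sum>i\<le>n. z i) = w \<and> (\<forall>i\<le>n. \<forall>x\<in>S i. z i \<bullet> (x, 1) > 0)"
  using assms
proof (induction n arbitrary: w)
  case 0
  then show ?case by (intro exI [of _ "\<lambda>_. w"]) simp
next
  case (Suc n)
  have "compact (\<Inter>i\<le>n. S i)" "convex (\<Inter>i\<le>n. S i)"
    using Suc.prems(1) by (auto intro!: compact_Inter convex_INT)
  moreover have "(\<Inter>i\<le>n. S i) \<inter> S (Suc n) = (\<Inter>i\<le>Suc n. S i)"
    by (auto simp: le_Suc_eq)
  ultimately obtain u where u: "\<And>x. x \<in> (\<Inter>i\<le>n. S i) \<Longrightarrow> u \<bullet> (x, 1) > 0"
    "\<And>x. x \<in> S (Suc n) \<Longrightarrow> (w - u) \<bullet> (x, 1) > 0"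
    using split_positive_affine [of "\<Inter>i\<le>n. S i" "S (Suc n)" w] Suc.prems by (metis order_refl)
  have "\<exists>z. (\<Sum>i\<le>n. z i) = u \<and> (\<forall>i\<le>n. \<forall>x\<in>S i. z i \<bullet> (x, 1) > 0)"
    using Suc.prems(1) u(1) by (intro Suc.IH) auto
  then obtain z where z: "(\<Sum>i\<le>n. z i) = u" "\<forall>i\<le>n. \<forall>x\<in>S i. z i \<bullet> (x, 1) > 0" by blast
  show ?case
    by (rule exI [of _ "z(Suc n := w - u)"]) (use z u(2) in \<open>auto simp: le_Suc_eq\<close>)
qed

text \<open>If the intersection is empty, even \<open>w = 0\<close> is vacuously positive on it, and
  its decomposition gives \<open>z\<close>. Conversely, at a common point the values of the
  \<open>z i\<close> would all be positive and yet sum to 0.\<close>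

lemma Inter_hulls_empty_iff:
  fixes S :: "nat \<Rightarrow> 'a::euclidean_space set"
  assumes fin: "\<And>i. i < r \<Longrightarrow> finite (S i)" and r: "r \<ge> 1"
  shows "(\<Inter>i<r. convex hull (S i)) = {} \<longleftrightarrow>
    (\<exists>z :: nat \<Rightarrow> 'a \<times> real. (\<Sum>i<r. z i) = 0 \<and> (\<forall>i<r. \<forall>x\<in>S i. z i \<bullet> (x, 1) > 0))"
proof
  assume e: "(\<Inter>i<r. convex hull (S i)) = {}"
  have "{..<r} = {..r - 1}" using r by auto
  moreover have "\<exists>z :: nat \<Rightarrow> 'a \<times> real. (\<Sum>i\<le>r - 1. z i) = 0 \<and>
      (\<forall>i\<le>r - 1. \<forall>x\<in>convex hull (S i). z i \<bullet> (x, 1) > 0)"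
    by (rule decompose_positive_affine)
      (use e r fin calculation in \<open>auto intro: finite_imp_compact_convex_hull\<close>)
  ultimately show "\<exists>z :: nat \<Rightarrow> 'a \<times> real. (\<Sum>i<r. z i) = 0 \<and> (\<forall>i<r. \<forall>x\<in>S i. z i \<bullet> (x, 1) > 0)"
    by (metis atMost_iff lessThan_iff hull_inc)
next
  assume "\<exists>z :: nat \<Rightarrow> 'a \<times> real. (\<Sum>i<r. z i) = 0 \<and> (\<forall>i<r. \<forall>x\<in>S i. z i \<bullet> (x, 1) > 0)"
  then obtain z :: "nat \<Rightarrow> 'a \<times> real"
    where z: "(\<Sum>i<r. z i) = 0" "\<And>i x. i < r \<Longrightarrow> x \<in> S i \<Longrightarrow> z i \<bullet> (x, 1) > 0" by blast
  show "(\<Inter>i<r. convex hull (S i)) = {}"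
  proof (rule ccontr)
    assume "\<not> ?thesis"
    then obtain q where q: "\<And>i. i < r \<Longrightarrow> q \<in> convex hull (S i)" by auto
    have "z i \<bullet> (q, 1) > 0" if "i < r" for i
    proof -
      have "convex {x. z i \<bullet> (x, 1) > 0}"
      proof -
        have "{x. z i \<bullet> (x, 1) > 0} = {x. fst (z i) \<bullet> x > - snd (z i)}"
          by (auto simp: inner_prod_def)
        then show ?thesis by (simp add: convex_halfspace_gt)
      qed
      moreover have "S i \<subseteq> {x. z i \<bullet> (x, 1) > 0}" using z(2) that by auto
      ultimately have "convex hull (S i) \<subseteq> {x. z i \<bullet> (x, 1) > 0}" by (simp add: hull_minimal)
      then show ?thesis using q that by blast
    qed
    then have "(\<Sum>i<r. z i \<bullet> (q, 1)) > 0" using r by (intro sum_pos) (auto simp: lessThan_empty_iff)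
    then show False using z(1) by (simp flip: inner_sum_left)
  qed
qed

section \<open>The Tverberg poset\<close>

text \<open>For tuples of equal length, inclusion of graphs is the componentwise order; disjointness
  of the components becomes single-valuedness. Trailing empty sets leave no trace, hence the length
  hypotheses below.\<close>

definition tuple_graph :: "'a set list \<Rightarrow> ('a \<times> nat) set" where
  "tuple_graph Xs = {(x, i). i < length Xs \<and> x \<in> Xs ! i}"

text \<open>In fact a linear space: \<open>r\<close> affine functions with sum zero, evaluated at
  pairs. Values at labels \<open>i \<ge> r\<close> are unconstrained; such pairs lie outside
  \<open>X \<times> {..<r}\<close>.\<close>

definition sarkaria_cone :: "nat \<Rightarrow> ('a::euclidean_space \<times> nat \<Rightarrow> real) set" where
  "sarkaria_cone r = {(\<lambda>(x, i). z i \<bullet> (x, 1)) | z :: nat \<Rightarrow> 'a \<times> real. (\<Sum>i<r. z i) = 0}"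

lemma tuple_graph_subset_iff:
  "length Xs = length Ys \<Longrightarrow> tuple_graph Xs \<subseteq> tuple_graph Ys \<longleftrightarrow> list_all2 (\<subseteq>) Xs Ys"
  by (auto simp: tuple_graph_def list_all2_conv_all_nth)

lemma tuple_graph_eq_iff:
  "length Xs = length Ys \<Longrightarrow> tuple_graph Xs = tuple_graph Ys \<longleftrightarrow> Xs = Ys"
  unfolding set_eq_subset tuple_graph_subset_iff
  by (metis list_all2_antisym list_all2_refl subset_antisym subset_refl tuple_graph_subset_iff)

lemma function_cone_sarkaria: "function_cone (sarkaria_cone r)"
  unfolding function_cone_def
proof (intro conjI ballI allI impI)
  show "(\<lambda>v. 0) \<in> sarkaria_cone r"
    unfolding sarkaria_cone_def by (auto intro!: exI [of _ "\<lambda>_. 0"])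
next
  fix y y' :: "'a \<times> nat \<Rightarrow> real" and s t :: real
  assume "y \<in> sarkaria_cone r" "y' \<in> sarkaria_cone r"
  then obtain z z' :: "nat \<Rightarrow> 'a \<times> real" where z: "(\<Sum>i<r. z i) = 0" "y = (\<lambda>(x, i). z i \<bullet> (x, 1))"
    and z': "(\<Sum>i<r. z' i) = 0" "y' = (\<lambda>(x, i). z' i \<bullet> (x, 1))"
    unfolding sarkaria_cone_def by blast
  have "(\<Sum>i<r. s *\<^sub>R z i + t *\<^sub>R z' i) = 0"
    by (simp add: sum.distrib z z' flip: scaleR_sum_right)
  then show "(\<lambda>v. s * y v + t * y' v) \<in> sarkaria_cone r"
    unfolding sarkaria_cone_def mem_Collect_eq z z'
    by (intro exI [of _ "\<lambda>i. s *\<^sub>R z i + t *\<^sub>R z' i"])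
      (auto simp: inner_add_left)
qed

text \<open>The values over a fixed \<open>x\<close> sum to 0.\<close>

lemma sarkaria_nonpos:
  fixes x :: "'a::euclidean_space"
  assumes y: "y \<in> sarkaria_cone r" and r: "r \<ge> 1"
  shows "\<exists>i<r. y (x, i) \<le> 0"
proof (rule ccontr)
  assume neg: "\<not> ?thesis"
  obtain z :: "nat \<Rightarrow> 'a \<times> real" where z: "(\<Sum>i<r. z i) = 0" "y = (\<lambda>(x, i). z i \<bullet> (x, 1))"
    using y unfolding sarkaria_cone_def by blast
  have "(\<Sum>i<r. z i \<bullet> (x, 1)) > 0"
    using neg r by (intro sum_pos) (auto simp: z not_le lessThan_empty_iff)
  then show False using z(1) by (simp flip: inner_sum_left)
qed

text \<open>The last vector \<open>z (r - 1)\<close> is minus the sum of the others, which are free;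
  this leaves \<open>r - 1\<close> vectors of dimension \<open>DIM('a) + 1\<close>.\<close>

lemma spanned_on_sarkaria:
  fixes X :: "'a::euclidean_space set"
  assumes r: "r \<ge> 1"
  shows "spanned_on (X \<times> {..<r}) ({..<r - 1} \<times> (Basis :: ('a \<times> real) set)) (sarkaria_cone r)"
proof -
  \<comment> \<open>The generator \<open>g (i, b)\<close> belongs to the family with
    \<open>b\<close> at \<open>i\<close>, \<open>- b\<close> at \<open>r - 1\<close> and 0
    elsewhere.\<close>
  define g :: "nat \<times> ('a \<times> real) \<Rightarrow> 'a \<times> nat \<Rightarrow> real" where
    "g = (\<lambda>(i, b) (x, j). ((x, 1) \<bullet> b) * ((if j = i then 1 else 0) - (if j = r - 1 then 1 else 0)))"
  have "\<exists>a. \<forall>v\<in>X \<times> {..<r}. y v = (\<Sum>i\<in>{..<r - 1} \<times> Basis. a i * g i v)"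
    if y: "y \<in> sarkaria_cone r" for y :: "'a \<times> nat \<Rightarrow> real"
  proof -
    obtain z :: "nat \<Rightarrow> 'a \<times> real" where z: "(\<Sum>i<r. z i) = 0" "y = (\<lambda>(x, i). z i \<bullet> (x, 1))"
      using y unfolding sarkaria_cone_def by blast
    define a where "a = (\<lambda>(i, b). z i \<bullet> b)"
    have "z j \<bullet> (x, 1) = (\<Sum>p\<in>{..<r - 1} \<times> Basis. a p * g p (x, j))" if j: "j < r" for x j
    proof -
      let ?e = "\<lambda>i. (if j = i then 1 else 0) - (if j = r - 1 then 1 else 0) :: real"
      have "(\<Sum>p\<in>{..<r - 1} \<times> Basis. a p * g p (x, j))
          = (\<Sum>i<r - 1. \<Sum>b\<in>Basis. (z i \<bullet> b) * (((x, 1) \<bullet> b) * ?e i))"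
        by (simp add: sum.cartesian_product a_def g_def case_prod_beta)
      also have "\<dots> = (\<Sum>i<r - 1. (z i \<bullet> (x, 1)) * ?e i)"
        by (simp add: euclidean_inner [of _ "(x, 1)"] sum_distrib_right mult.assoc)
      also have "\<dots> = z j \<bullet> (x, 1)"
      proof (cases "j = r - 1")
        case True
        have "(\<Sum>i<r. z i) = (\<Sum>i<r - 1. z i) + z (r - 1)"
          using r by (metis Suc_diff_1 less_eq_Suc_le One_nat_def sum.lessThan_Suc)
        then have "z j = - (\<Sum>i<r - 1. z i)" using z(1) True by (simp add: eq_neg_iff_add_eq_0 add.commute)
        then have "z j \<bullet> (x, 1) = - (\<Sum>i<r - 1. z i \<bullet> (x, 1))" by (simp add: inner_sum_left)
        moreover have "(\<Sum>i<r - 1. (z i \<bullet> (x, 1)) * ?e i) = (\<Sum>i<r - 1. - (z i \<bullet> (x, 1)))"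
          using True by (intro sum.cong) auto
        ultimately show ?thesis by (simp add: sum_negf)
      next
        case False
        have "(\<Sum>i<r - 1. (z i \<bullet> (x, 1)) * ?e i) = (\<Sum>i<r - 1. if i = j then z j \<bullet> (x, 1) else 0)"
          using False by (intro sum.cong) auto
        then show ?thesis using False j by simp
      qed
      finally show ?thesis by simp
    qed
    then show ?thesis by (intro exI [of _ a]) (auto simp: z(2))
  qed
  then show ?thesis unfolding spanned_on_def by blast
qed

lemma tuple_graph_tver_vertices:
  fixes X :: "'a::euclidean_space set"
  assumes X: "finite X" and r: "r \<ge> 1"
  shows "tuple_graph ` tver_vertices X r = blocked (X \<times> {..<r}) (sarkaria_cone r)"
proof -
  have key: "Xs \<in> tver_vertices X r \<longleftrightarrow> tuple_graph Xs \<in> blocked (X \<times> {..<r}) (sarkaria_cone r)"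
    if len: "length Xs = r" for Xs :: "'a set list"
  proof -
    have sub: "tuple_graph Xs \<subseteq> X \<times> {..<r} \<longleftrightarrow> (\<forall>i<r. Xs ! i \<subseteq> X)"
      by (auto simp: tuple_graph_def len)
    have sv: "single_valued (tuple_graph Xs) \<longleftrightarrow>
        (\<forall>i<r. \<forall>j<r. i \<noteq> j \<longrightarrow> Xs ! i \<inter> Xs ! j = {})"
      unfolding single_valued_def tuple_graph_def len by auto
    have "(\<Inter>i\<in>{..<r}. convex hull (Xs ! i)) \<noteq> {} \<longleftrightarrow>
        (\<forall>y\<in>sarkaria_cone r. \<exists>v\<in>tuple_graph Xs. y v \<le> 0)" if "\<forall>i<r. Xs ! i \<subseteq> X"
    proof -
      have "(\<Inter>i\<in>{..<r}. convex hull (Xs ! i)) = {} \<longleftrightarrow>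
          (\<exists>z :: nat \<Rightarrow> 'a \<times> real. (\<Sum>i<r. z i) = 0 \<and> (\<forall>i<r. \<forall>x\<in>Xs ! i. z i \<bullet> (x, 1) > 0))"
        using that X by (intro Inter_hulls_empty_iff [OF _ r]) (auto intro: finite_subset)
      also have "\<dots> \<longleftrightarrow> (\<exists>y\<in>sarkaria_cone r. \<forall>v\<in>tuple_graph Xs. y v > 0)"
        by (fastforce simp: sarkaria_cone_def tuple_graph_def len)
      finally show ?thesis by (meson not_le)
    qed
    then show ?thesis
      using sub sv len by (auto simp: tver_vertices_def blocked_def sections_def)
  qed
  show ?thesis
  proof (intro equalityI subsetI)
    fix \<sigma> assume "\<sigma> \<in> tuple_graph ` tver_vertices X r"
    then show "\<sigma> \<in> blocked (X \<times> {..<r}) (sarkaria_cone r)"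
      using key by (auto simp: tver_vertices_def)
  next
    fix \<sigma> assume s: "\<sigma> \<in> blocked (X \<times> {..<r}) (sarkaria_cone r)"
    define Xs where "Xs = map (\<lambda>i. {x. (x, i) \<in> \<sigma>}) [0..<r]"
    have "tuple_graph Xs = \<sigma>"
      using s by (auto simp: tuple_graph_def Xs_def blocked_def sections_def)
    moreover have "length Xs = r" by (simp add: Xs_def)
    ultimately show "\<sigma> \<in> tuple_graph ` tver_vertices X r" using key s by blast
  qed
qed

theorem theorem7p13:
  fixes X :: "'a::euclidean_space set" and r m :: nat
  assumes "finite X" and "r \<ge> 1"
    and "card X \<ge> (DIM('a) + 1) * (r - 1) + m + 1"
  shows "\<forall>j::int. -1 \<le> j \<and> j \<le> int m - 1 \<longrightarrow>
           reduced_homology_vanishes tver_lt (tver_vertices X r) j"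
proof (intro allI impI)
  fix j :: int assume j: "-1 \<le> j \<and> j \<le> int m - 1"
  \<comment> \<open>A \<open>j\<close>-simplex has \<open>k = j + 1\<close> vertices, so the range
    of \<open>j\<close> becomes \<open>0 \<le> k \<le> m\<close>.\<close>
  define k where "k = nat (j + 1)"
  have k: "j = int k - 1" "k \<le> m" using j by (auto simp: k_def)
  let ?V = "tver_vertices X r" and ?E = "X \<times> {..<r}"
  let ?I = "{..<r - 1} \<times> (Basis :: ('a \<times> real) set)"
  have "?V \<subseteq> {Xs. set Xs \<subseteq> Pow X \<and> length Xs = r}"
    unfolding tver_vertices_def by (force simp: in_set_conv_nth)
  then have "finite ?V"
    using assms(1) finite_lists_length_eq [of "Pow X" r] by (auto intro: finite_subset)
  moreover have len: "length Xs = r" if "Xs \<in> ?V" for Xs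
    using that by (simp add: tver_vertices_def)
  ultimately interpret order_embedding tver_lt ?V tuple_graph
    by unfold_locales
      (auto simp: inj_on_def tver_lt_def psubset_eq tuple_graph_eq_iff tuple_graph_subset_iff)
  have "finite_ambient.exact_at (Pow ?E) (blocked ?E (sarkaria_cone r)) k"
  proof (rule exact_at_blocked [where X = X and I = ?I])
    show "finite ?E" using assms(1) by simp
    show "fst ` ?E = X" using assms(2) by (auto simp: fst_image_times lessThan_empty_iff)
    \<comment> \<open>\<open>card ?I\<close> is \<open>(r - 1) * (DIM('a) + 1)\<close>, so for
      \<open>k = m\<close> this is exactly the cardinality hypothesis.\<close>
    show "k + card ?I + 1 \<le> card X"
      using assms(3) k(2) by (simp add: card_cartesian_product algebra_simps)
    show "\<exists>l. (x, l) \<in> ?E \<and> y (x, l) \<le> 0" if "y \<in> sarkaria_cone r" "x \<in> X" for y x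
      using sarkaria_nonpos [OF that(1) assms(2)] that(2) by auto
    show "spanned_on ?E ?I (sarkaria_cone r)" by (rule spanned_on_sarkaria [OF assms(2)])
  qed (auto simp: function_cone_sarkaria)
  moreover have "tuple_graph ` ?V = blocked ?E (sarkaria_cone r)"
    using assms by (intro tuple_graph_tver_vertices)
  moreover have "blocked ?E (sarkaria_cone r) \<subseteq> Pow ?E" by (auto simp: blocked_def sections_def)
  moreover have "finite_ambient (Pow ?E)" using assms(1) by unfold_locales simp
  \<comment> \<open>Exactness was obtained in the ambient \<open>Pow ?E\<close>, while the transfer
    lemma takes the poset itself as ambient.\<close>
  ultimately have "exact_at (tuple_graph ` ?V) k"
    using finite_ambient.exact_at_subambient by (metis subset_refl)
  then show "reduced_homology_vanishes tver_lt ?V j"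
    unfolding k(1) by (rule reduced_homology_vanishes_if_exact_at)
qed

end
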